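(* The contravariant functors $\mathcal{P}$ and $\mathrm{at}$ restrict to a dual adjunction, with units $\varepsilon$ and $\eta$, between the category $\mathbf{StKSob}$ of stably compact spaces and proper maps and the category $\mathbf{StKMT}$ of stably compact MT-algebras and proper MT-morphisms. Moreover, they restrict to a dual equivalence between $\mathbf{StKSob}$ and the full subcategory $\mathbf{StKSMT}$ of $\mathbf{StKMT}$ consisting of the spatial algebras.
   Context: An MT-algebra is a pair $M=(B,\square)$ where $B$ is a complete boolean algebra and $\square:B\to B$ satisfies $\square 1=1$, $\square(a\wedge b)=\square a\wedge\square b$, $\square a\le a$, $\square a\le\square\square a$. An MT-morphism $f:M\to N$ is a complete boolean homomorphism with $f(\square_M a)\le\square_N f(a)$ for all $a$. Put $\diamond a=\neg\square\neg a$. An element $a$ is open if $a=\square a$ and closed if $a=\diamond a$; $\mathrm{O}(M)$ and $\mathrm{C}(M)$ are the sets of open and closed elements. An element is saturated if it is a meet of open elements, and weakly locally closed if it is the meet of a saturated element and a closed element. $M$ is a $T_0$-algebra if every element is a join of weakly locally closed elements. $M$ is sober if it is a $T_0$-algebra and each join-irreducible (nonzero) element $p$ of $\mathrm{C}(M)$ is of the form $p=\diamond x$ for an atom $x$ of $M$. $M$ is spatial if $B$ is atomic. An element $a$ is compact if for each $S\subseteq\mathrm{O}(M)$ with $a\le\bigvee S$ there is a finite $T\subseteq S$ with $a\le\bigvee T$; $M$ is compact if its top element is compact; $\mathrm{KS}(M)$ is the set of compact saturated elements. For $a,b\in M$ write $a\vartriangleleft b$ if there is a compact $k$ with $a\le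 k\le b$. $M$ is locally compact if $u=\bigvee\{v\in\mathrm{O}(M)\mid v\vartriangleleft u\}$ for all $u\in\mathrm{O}(M)$. $M$ is stably locally compact if it is locally compact, sober, and $k,m\in\mathrm{KS}(M)$ implies $k\wedge m\in\mathrm{KS}(M)$; it is stably compact if it is stably locally compact and compact. An MT-morphism $f:M\to N$ between locally compact sober MT-algebras is proper if $a\in\mathrm{KS}(M)$ implies $f(a)\in\mathrm{KS}(N)$. A space is stably compact if it is compact, sober, locally compact (for each open $U$ and $x\in U$ there are an open $V$ and a compact $K$ with $x\in V\subseteq K\subseteq U$), and the intersection of any two compact saturated sets is compact (saturated = intersection of open sets). A continuous map $f:X\to Y$ between locally compact sober spaces is proper if $f^{-1}(K)$ is compact for each compact saturated $K\subseteq Y$. Functors: $\mathcal{P}$ sends a space $X$ to $(\mathcal{P}(X),\mathrm{int})$ (the powerset with the interior operator) and a map $f$ to $f^{-1}$. $\mathrm{at}$ sends $M$ to its set of atoms $\mathrm{at}(M)$ with topology $\{\eta(a)\mid a\in\mathrm{O}(M)\}$, where $\eta(a)=\{x\in\mathrm{at}(M)\mid x\le a\}$, and an MT-morphism $f:M\to N$ to $\mathrm{at}(f):\mathrm{at}(N)\to\mathrm{at}(M)$, the restriction to atoms of the left adjoint $f^*(x)=\bigwedge\{a\in M\mid x\le f(a)\}$. The units are $\eta_M:M\to\mathcal{P}(\mathrm{at}(M))$ and $\varepsilon_X:X\to\mathrm{at}(\mathcal{P}(X))$, $\varepsilon_X(x)=\{x\}$. *)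

theory Defs
  imports "HOL-Analysis.Analysis" "HOL-Algebra.Complete_Lattice"
begin

section \<open>MT-algebras\<close>

text \<open>
  The library type class \<open>complete_boolean_algebra\<close> demands complete distributivity and so only
  covers atomic algebras. Complete boolean algebras are therefore taken to be complemented
  distributive complete lattices (in the sense of HOL-Algebra, with an explicit carrier).
\<close>

record 'a mt = "'a gorder" +
  mbox :: "'a \<Rightarrow> 'a" (\<open>\<box>\<index>_\<close> [95] 95)

locale complete_boolean_lattice = Complete_Lattice.complete_lattice L for L (structure) +
  assumes meet_join_distrib:
      "\<lbrakk>a \<in> carrier L; b \<in> carrier L; c \<in> carrier L\<rbrakk> \<Longrightarrow> a \<sqinter> (b \<squnion> c) = (a \<sqinter> b) \<squnion> (a \<sqinter> c)"
    and complemented: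
      "a \<in> carrier L \<Longrightarrow> \<exists>b\<in>carrier L. a \<sqinter> b = \<bottom> \<and> a \<squnion> b = \<top>"

locale mt_algebra = complete_boolean_lattice M for M :: "('a, 'b) mt_scheme" (structure) +
  assumes mbox_closed: "a \<in> carrier M \<Longrightarrow> \<box>a \<in> carrier M"
    and mbox_top: "\<box>\<top> = \<top>"
    and mbox_meet: "\<lbrakk>a \<in> carrier M; b \<in> carrier M\<rbrakk> \<Longrightarrow> \<box>(a \<sqinter> b) = \<box>a \<sqinter> \<box>b"
    and mbox_le: "a \<in> carrier M \<Longrightarrow> \<box>a \<sqsubseteq> a"
    and mbox_idem: "a \<in> carrier M \<Longrightarrow> \<box>a \<sqsubseteq> \<box>\<box>a"

definition mt_compl :: "('a, 'b) gorder_scheme \<Rightarrow> 'a \<Rightarrow> 'a" where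
  "mt_compl M a = (THE b. b \<in> carrier M \<and> a \<sqinter>\<^bsub>M\<^esub> b = \<bottom>\<^bsub>M\<^esub> \<and> a \<squnion>\<^bsub>M\<^esub> b = \<top>\<^bsub>M\<^esub>)"

definition mt_diamond :: "('a, 'b) mt_scheme \<Rightarrow> 'a \<Rightarrow> 'a" where
  "mt_diamond M a = mt_compl M (\<box>\<^bsub>M\<^esub>(mt_compl M a))"

definition mt_opens :: "('a, 'b) mt_scheme \<Rightarrow> 'a set" where
  "mt_opens M = {a \<in> carrier M. \<box>\<^bsub>M\<^esub>a = a}"

definition mt_closeds :: "('a, 'b) mt_scheme \<Rightarrow> 'a set" where
  "mt_closeds M = {a \<in> carrier M. mt_diamond M a = a}"

definition mt_saturated :: "('a, 'b) mt_scheme \<Rightarrow> 'a \<Rightarrow> bool" where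
  "mt_saturated M a \<longleftrightarrow> (\<exists>S \<subseteq> mt_opens M. a = \<Sqinter>\<^bsub>M\<^esub>S)"

definition weakly_locally_closed :: "('a, 'b) mt_scheme \<Rightarrow> 'a \<Rightarrow> bool" where
  "weakly_locally_closed M a \<longleftrightarrow>
     (\<exists>s c. mt_saturated M s \<and> c \<in> mt_closeds M \<and> a = s \<sqinter>\<^bsub>M\<^esub> c)"

definition mt_T0 :: "('a, 'b) mt_scheme \<Rightarrow> bool" where
  "mt_T0 M \<longleftrightarrow>
     (\<forall>a\<in>carrier M. \<exists>S. (\<forall>s\<in>S. weakly_locally_closed M s) \<and> a = \<Squnion>\<^bsub>M\<^esub>S)"

definition mt_atoms :: "('a, 'b) gorder_scheme \<Rightarrow> 'a set" where
  "mt_atoms M = {x \<in> carrier M. x \<noteq> \<bottom>\<^bsub>M\<^esub> \<and>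
     (\<forall>y\<in>carrier M. y \<sqsubseteq>\<^bsub>M\<^esub> x \<longrightarrow> y = \<bottom>\<^bsub>M\<^esub> \<or> y = x)}"

text \<open>Finite joins of closed elements are closed, so joins in the lattice of closed elements
  are computed in the whole algebra.\<close>

definition join_irreducible_closed :: "('a, 'b) mt_scheme \<Rightarrow> 'a \<Rightarrow> bool" where
  "join_irreducible_closed M p \<longleftrightarrow> p \<in> mt_closeds M \<and> p \<noteq> \<bottom>\<^bsub>M\<^esub> \<and>
     (\<forall>a\<in>mt_closeds M. \<forall>b\<in>mt_closeds M. p = a \<squnion>\<^bsub>M\<^esub> b \<longrightarrow> p = a \<or> p = b)"

definition mt_sober :: "('a, 'b) mt_scheme \<Rightarrow> bool" where
  "mt_sober M \<longleftrightarrow> mt_T0 M \<and>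
     (\<forall>p. join_irreducible_closed M p \<longrightarrow> (\<exists>x\<in>mt_atoms M. p = mt_diamond M x))"

definition mt_spatial :: "('a, 'b) mt_scheme \<Rightarrow> bool" where
  "mt_spatial M \<longleftrightarrow> (\<forall>a\<in>carrier M. a \<noteq> \<bottom>\<^bsub>M\<^esub> \<longrightarrow> (\<exists>x\<in>mt_atoms M. x \<sqsubseteq>\<^bsub>M\<^esub> a))"

definition mt_compact :: "('a, 'b) mt_scheme \<Rightarrow> 'a \<Rightarrow> bool" where
  "mt_compact M a \<longleftrightarrow> a \<in> carrier M \<and>
     (\<forall>S \<subseteq> mt_opens M. a \<sqsubseteq>\<^bsub>M\<^esub> \<Squnion>\<^bsub>M\<^esub>S \<longrightarrow> (\<exists>T \<subseteq> S. finite T \<and> a \<sqsubseteq>\<^bsub>M\<^esub> \<Squnion>\<^bsub>M\<^esub>T))"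

definition KS :: "('a, 'b) mt_scheme \<Rightarrow> 'a set" where
  "KS M = {a. mt_compact M a \<and> mt_saturated M a}"

definition compactly_below :: "('a, 'b) mt_scheme \<Rightarrow> 'a \<Rightarrow> 'a \<Rightarrow> bool" where
  "compactly_below M a b \<longleftrightarrow> (\<exists>k. mt_compact M k \<and> a \<sqsubseteq>\<^bsub>M\<^esub> k \<and> k \<sqsubseteq>\<^bsub>M\<^esub> b)"

definition mt_locally_compact :: "('a, 'b) mt_scheme \<Rightarrow> bool" where
  "mt_locally_compact M \<longleftrightarrow>
     (\<forall>u\<in>mt_opens M. u = \<Squnion>\<^bsub>M\<^esub>{v \<in> mt_opens M. compactly_below M v u})"

definition mt_stably_locally_compact :: "('a, 'b) mt_scheme \<Rightarrow> bool" where
  "mt_stably_locally_compact M \<longleftrightarrow> mt_locally_compact M \<and> mt_sober M \<and>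
     (\<forall>k\<in>KS M. \<forall>m\<in>KS M. k \<sqinter>\<^bsub>M\<^esub> m \<in> KS M)"

definition mt_stably_compact :: "('a, 'b) mt_scheme \<Rightarrow> bool" where
  "mt_stably_compact M \<longleftrightarrow> mt_stably_locally_compact M \<and> mt_compact M \<top>\<^bsub>M\<^esub>"

text \<open>Morphisms are extensional functions (undefined off the carrier), so that equality of
  functions is equality of morphisms and composition is \<^const>\<open>compose\<close>.\<close>

definition mt_hom :: "('a, 'c) mt_scheme \<Rightarrow> ('b, 'd) mt_scheme \<Rightarrow> ('a \<Rightarrow> 'b) set" where
  "mt_hom M N = {f \<in> carrier M \<rightarrow>\<^sub>E carrier N.
     (\<forall>S \<subseteq> carrier M. f (\<Squnion>\<^bsub>M\<^esub>S) = \<Squnion>\<^bsub>N\<^esub>(f ` S)) \<and>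
     (\<forall>S \<subseteq> carrier M. f (\<Sqinter>\<^bsub>M\<^esub>S) = \<Sqinter>\<^bsub>N\<^esub>(f ` S)) \<and>
     (\<forall>a\<in>carrier M. f (mt_compl M a) = mt_compl N (f a)) \<and>
     (\<forall>a\<in>carrier M. f (\<box>\<^bsub>M\<^esub>a) \<sqsubseteq>\<^bsub>N\<^esub> \<box>\<^bsub>N\<^esub>(f a))}"

definition mt_proper_hom :: "('a, 'c) mt_scheme \<Rightarrow> ('b, 'd) mt_scheme \<Rightarrow> ('a \<Rightarrow> 'b) set" where
  "mt_proper_hom M N = {f \<in> mt_hom M N. \<forall>a\<in>KS M. f a \<in> KS N}"

definition mt_id :: "('a, 'b) mt_scheme \<Rightarrow> 'a \<Rightarrow> 'a" where
  "mt_id M = (\<lambda>a\<in>carrier M. a)"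

definition StKMT :: "'a mt set" where
  "StKMT = {M. mt_algebra M \<and> mt_stably_compact M}"

definition StKSMT :: "'a mt set" where
  "StKSMT = {M \<in> StKMT. mt_spatial M}"

definition mt_proper_iso :: "('a, 'c) mt_scheme \<Rightarrow> ('b, 'd) mt_scheme \<Rightarrow> ('a \<Rightarrow> 'b) \<Rightarrow> bool" where
  "mt_proper_iso M N f \<longleftrightarrow> f \<in> mt_proper_hom M N \<and>
     (\<exists>g\<in>mt_proper_hom N M. compose (carrier M) g f = mt_id M \<and>
        compose (carrier N) f g = mt_id N)"


section \<open>Stably compact spaces\<close>

definition saturated_in :: "'a topology \<Rightarrow> 'a set \<Rightarrow> bool" where
  "saturated_in X S \<longleftrightarrow> (\<exists>\<U>. (\<forall>U\<in>\<U>. openin X U) \<and> S = topspace X \<inter> \<Inter>\<U>)"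

definition irreducible_closed_in :: "'a topology \<Rightarrow> 'a set \<Rightarrow> bool" where
  "irreducible_closed_in X C \<longleftrightarrow> closedin X C \<and> C \<noteq> {} \<and>
     (\<forall>A B. closedin X A \<and> closedin X B \<and> C = A \<union> B \<longrightarrow> C = A \<or> C = B)"

text \<open>Uniqueness of the generic point includes the \<open>T\<^sub>0\<close> axiom.\<close>

definition sober_space :: "'a topology \<Rightarrow> bool" where
  "sober_space X \<longleftrightarrow>
     (\<forall>C. irreducible_closed_in X C \<longrightarrow> (\<exists>!x. x \<in> topspace X \<and> C = X closure_of {x}))"

text \<open>The library's \<^const>\<open>locally_compact_space\<close> asks only for one compact neighbourhood of
  each point, which is weaker than the present notion for non-Hausdorff spaces.\<close>

definition stably_compact_space :: "'a topology \<Rightarrow> bool" where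
  "stably_compact_space X \<longleftrightarrow> compact_space X \<and> sober_space X \<and>
     neighbourhood_base_of (compactin X) X \<and>
     (\<forall>K L. compactin X K \<and> saturated_in X K \<and> compactin X L \<and> saturated_in X L
        \<longrightarrow> compactin X (K \<inter> L))"

definition proper_cmap :: "'a topology \<Rightarrow> 'b topology \<Rightarrow> ('a \<Rightarrow> 'b) set" where
  "proper_cmap X Y = {f \<in> extensional (topspace X). continuous_map X Y f \<and>
     (\<forall>K. compactin Y K \<and> saturated_in Y K \<longrightarrow> compactin X {x \<in> topspace X. f x \<in> K})}"

definition space_id :: "'a topology \<Rightarrow> 'a \<Rightarrow> 'a" where
  "space_id X = (\<lambda>x\<in>topspace X. x)"

definition StKSob :: "'a topology set" where
  "StKSob = {X. stably_compact_space X}"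

definition proper_homeo :: "'a topology \<Rightarrow> 'b topology \<Rightarrow> ('a \<Rightarrow> 'b) \<Rightarrow> bool" where
  "proper_homeo X Y f \<longleftrightarrow> f \<in> proper_cmap X Y \<and>
     (\<exists>g\<in>proper_cmap Y X. compose (topspace X) g f = space_id X \<and>
        compose (topspace Y) f g = space_id Y)"


section \<open>The functors and the units\<close>

text \<open>The functors change the type of the carrier (a space on \<^typ>\<open>'a\<close> becomes an algebra on
  \<^typ>\<open>'a set\<close>), so objects and morphisms range over arbitrary, independent carrier types.\<close>

definition pow_mt :: "'a topology \<Rightarrow> 'a set mt" where
  "pow_mt X = \<lparr>carrier = Pow (topspace X), eq = (=), le = (\<subseteq>), mbox = (\<lambda>A. X interior_of A)\<rparr>"

definition pow_map :: "'a topology \<Rightarrow> 'b topology \<Rightarrow> ('a \<Rightarrow> 'b) \<Rightarrow> 'b set \<Rightarrow> 'a set" where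
  "pow_map X Y f = (\<lambda>B\<in>Pow (topspace Y). {x \<in> topspace X. f x \<in> B})"

definition mt_eta :: "('a, 'b) mt_scheme \<Rightarrow> 'a \<Rightarrow> 'a set" where
  "mt_eta M = (\<lambda>a\<in>carrier M. {x \<in> mt_atoms M. x \<sqsubseteq>\<^bsub>M\<^esub> a})"

definition at_space :: "('a, 'b) mt_scheme \<Rightarrow> 'a topology" where
  "at_space M = topology (\<lambda>U. U \<in> mt_eta M ` mt_opens M)"

text \<open>The left adjoint of \<open>f\<close>, restricted to atoms.\<close>

definition at_map ::
  "('a, 'c) mt_scheme \<Rightarrow> ('b, 'd) mt_scheme \<Rightarrow> ('a \<Rightarrow> 'b) \<Rightarrow> 'b \<Rightarrow> 'a" where
  "at_map M N f = (\<lambda>x\<in>mt_atoms N. \<Sqinter>\<^bsub>M\<^esub>{a \<in> carrier M. x \<sqsubseteq>\<^bsub>N\<^esub> f a})"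

definition space_eps :: "'a topology \<Rightarrow> 'a \<Rightarrow> 'a set" where
  "space_eps X = (\<lambda>x\<in>topspace X. {x})"

text \<open>\<^const>\<open>topology\<close> is only meaningful for families that are topologies; the following shows
  that this is the case in \<^const>\<open>at_space\<close>.\<close>

context mt_algebra
begin

lemma atom_le_Sup:
  assumes "x \<in> mt_atoms M" "S \<subseteq> carrier M" "x \<sqsubseteq> \<Squnion>S"
  shows "\<exists>s\<in>S. x \<sqsubseteq> s"
proof (rule ccontr)
  assume neg: "\<not> (\<exists>s\<in>S. x \<sqsubseteq> s)"
  have x: "x \<in> carrier M" "x \<noteq> \<bottom>" "\<And>y. y \<in> carrier M \<Longrightarrow> y \<sqsubseteq> x \<Longrightarrow> y = \<bottom> \<or> y = x"
    using assms(1) by (auto simp: mt_atoms_def)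
  obtain c where c: "c \<in> carrier M" "x \<sqinter> c = \<bottom>" "x \<squnion> c = \<top>"
    using complemented x(1) by blast
  have "s \<sqsubseteq> c" if "s \<in> S" for s
  proof -
    have s: "s \<in> carrier M" using that assms(2) by blast
    have "x \<sqinter> s \<noteq> x"
      using neg that meet_right[OF x(1) s] by auto
    then have "x \<sqinter> s = \<bottom>"
      using x(3)[OF meet_closed[OF x(1) s] meet_left[OF x(1) s]] by blast
    then have sx: "s \<sqinter> x = \<bottom>" by (simp add: meet_comm)
    have sT: "s \<sqinter> (x \<squnion> c) = s"
      unfolding c(3) using le_iff_join[OF s top_closed] top_higher[OF s] by simp
    have "s = (s \<sqinter> x) \<squnion> (s \<sqinter> c)"
      using meet_join_distrib[OF s x(1) c(1)] sT by simp
    also have "\<dots> = s \<sqinter> c"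
      unfolding sx using le_iff_meet[OF bottom_closed meet_closed[OF s c(1)]]
        bottom_lower[OF meet_closed[OF s c(1)]] by simp
    finally show "s \<sqsubseteq> c" using le_iff_join[OF s c(1)] by simp
  qed
  then have "\<Squnion>S \<sqsubseteq> c" using c(1) assms(2) by (intro sup_least) auto
  then have "x \<sqsubseteq> c" using le_trans[OF assms(3)] assms(2) c(1) x(1) by simp
  then show False using le_iff_join[OF x(1) c(1)] c(2) x(2) by simp
qed

lemma mbox_mono:
  assumes "a \<in> carrier M" "b \<in> carrier M" "a \<sqsubseteq> b"
  shows "\<box>a \<sqsubseteq> \<box>b"
proof -
  have "a \<sqinter> b = a"
    using assms le_iff_join by simp
  then have "\<box>a = \<box>a \<sqinter> \<box>b"
    using mbox_meet[OF assms(1,2)] by simp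
  then show ?thesis
    using le_iff_join[OF mbox_closed mbox_closed] assms by blast
qed

lemma mt_opens_Sup:
  assumes "S \<subseteq> mt_opens M"
  shows "\<Squnion>S \<in> mt_opens M"
proof -
  have S: "S \<subseteq> carrier M" using assms by (auto simp: mt_opens_def)
  have "s \<sqsubseteq> \<box>(\<Squnion>S)" if "s \<in> S" for s
  proof -
    have "s \<in> carrier M" "\<box>s = s" using that assms by (auto simp: mt_opens_def)
    then show ?thesis using mbox_mono[of s "\<Squnion>S"] S that by (simp add: sup_upper)
  qed
  then have "\<Squnion>S \<sqsubseteq> \<box>(\<Squnion>S)" using S mbox_closed by (intro sup_least) auto
  then show ?thesis
    using S mbox_le[of "\<Squnion>S"] mbox_closed le_antisym by (auto simp: mt_opens_def)
qed

lemma istopology_at: "istopology (\<lambda>U. U \<in> mt_eta M ` mt_opens M)"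
  unfolding istopology_def
proof (intro conjI allI impI)
  fix U V assume "U \<in> mt_eta M ` mt_opens M" "V \<in> mt_eta M ` mt_opens M"
  then obtain u v where *: "u \<in> mt_opens M" "v \<in> mt_opens M" "U = mt_eta M u" "V = mt_eta M v"
    by auto
  then have uv: "u \<in> carrier M" "v \<in> carrier M" by (auto simp: mt_opens_def)
  have "x \<sqsubseteq> u \<sqinter> v \<longleftrightarrow> x \<sqsubseteq> u \<and> x \<sqsubseteq> v" if "x \<in> carrier M" for x
  proof
    assume "x \<sqsubseteq> u \<sqinter> v"
    then show "x \<sqsubseteq> u \<and> x \<sqsubseteq> v"
      using le_trans[OF _ meet_left[OF uv]] le_trans[OF _ meet_right[OF uv]] that uv by simp
  next
    assume "x \<sqsubseteq> u \<and> x \<sqsubseteq> v"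
    then show "x \<sqsubseteq> u \<sqinter> v" using meet_le that uv by blast
  qed
  then have "U \<inter> V = mt_eta M (u \<sqinter> v)"
    using * uv by (auto simp: mt_eta_def mt_atoms_def)
  moreover have "u \<sqinter> v \<in> mt_opens M"
    using * mbox_meet by (auto simp: mt_opens_def)
  ultimately show "U \<inter> V \<in> mt_eta M ` mt_opens M" by blast
next
  fix \<K> assume "\<forall>K\<in>\<K>. K \<in> mt_eta M ` mt_opens M"
  then have "\<K> \<subseteq> mt_eta M ` mt_opens M" by blast
  then obtain S where S: "S \<subseteq> mt_opens M" "\<K> = mt_eta M ` S"
    by (auto simp: subset_image_iff)
  have c: "S \<subseteq> carrier M" using S by (auto simp: mt_opens_def)
  have "\<Union>\<K> = mt_eta M (\<Squnion>S)"
  proof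
    have "x \<sqsubseteq> \<Squnion>S" if "s \<in> S" "x \<in> carrier M" "x \<sqsubseteq> s" for x s
      using le_trans[OF that(3) sup_upper[OF c that(1)]] that c by auto
    then show "\<Union>\<K> \<subseteq> mt_eta M (\<Squnion>S)"
      unfolding S(2) using c by (auto simp: mt_eta_def mt_atoms_def)
    show "mt_eta M (\<Squnion>S) \<subseteq> \<Union>\<K>"
    proof
      fix x assume "x \<in> mt_eta M (\<Squnion>S)"
      then have x: "x \<in> mt_atoms M" "x \<sqsubseteq> \<Squnion>S"
        using c by (auto simp: mt_eta_def)
      then obtain s where "s \<in> S" "x \<sqsubseteq> s" using atom_le_Sup c by blast
      then show "x \<in> \<Union>\<K>"
        unfolding S(2) using x c by (auto simp: mt_eta_def)
    qed
  qed
  then show "\<Union>\<K> \<in> mt_eta M ` mt_opens M" using mt_opens_Sup[OF S(1)] by blast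
qed

end

end

theory Submission
  imports Defs
begin

text \<open>
  Everything hinges on \<^term>\<open>mt_eta M\<close> being a proper morphism although \<^term>\<open>M\<close> need not be atomic. In a
  sober algebra there are enough atoms to separate compact saturated elements from open ones:
  if every atom below a compact saturated \<open>k\<close> is below an open \<open>u\<close>, then \<open>k\<close> is below \<open>u\<close>.
  So \<^term>\<open>mt_eta M\<close> maps compact saturated elements onto the compact saturated sets of
  atoms. This transfers stable compactness from \<^term>\<open>M\<close> to its space of atoms, and together with the
  identity \<open>at(f)\<inverse>(\<eta>(a)) = \<eta>(f a)\<close> it yields properness of \<open>at(f)\<close>.
\<close>

section \<open>Complements and atoms\<close>

text \<open>The obstacle is that \<open>mt_eta M\<close> need not be injective: several open or
  closed elements may have the same atoms below them, and an inclusion between sets of atoms says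
  little about the elements themselves. Hence sets of atoms are lifted back to \<open>M\<close> by
  canonical choices. A closed set is represented by the least closed element that yields it, so that
  irreducibility of the set passes to the element. A compact saturated set is represented by the
  meet of all open elements whose image contains it, so that compactness passes to the element. On
  the side of morphisms, preservation of all meets provides the left adjoint, and preservation of
  complements makes it send atoms to atoms. In the spatial case inclusion of sets of atoms is
  equivalent to the order, and taking joins of sets of atoms inverts
  \<open>mt_eta M\<close>.\<close>

context complete_boolean_lattice
begin

(* As introduction rules these make the classical reasoner loop. *)
declare le_cong_l [rule del] le_cong_r [rule del] le_antisym [rule del] weak_refl [rule del]

lemma le_meet_iff:
  assumes "x \<in> carrier L" "a \<in> carrier L" "b \<in> carrier L"
  shows "x \<sqsubseteq> a \<sqinter> b \<longleftrightarrow> x \<sqsubseteq> a \<and> x \<sqsubseteq> b"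
  using le_trans[OF _ meet_left[OF assms(2,3)]] le_trans[OF _ meet_right[OF assms(2,3)]]
    meet_le[of x a b] assms by auto

lemma join_le_iff:
  assumes "x \<in> carrier L" "a \<in> carrier L" "b \<in> carrier L"
  shows "a \<squnion> b \<sqsubseteq> x \<longleftrightarrow> a \<sqsubseteq> x \<and> b \<sqsubseteq> x"
  using le_trans[OF join_left[OF assms(2,3)]] le_trans[OF join_right[OF assms(2,3)]]
    join_le[of a x b] assms by auto

lemma le_Inf_iff:
  assumes "x \<in> carrier L" "S \<subseteq> carrier L"
  shows "x \<sqsubseteq> \<Sqinter>S \<longleftrightarrow> (\<forall>s\<in>S. x \<sqsubseteq> s)"
proof
  assume "x \<sqsubseteq> \<Sqinter>S"
  then show "\<forall>s\<in>S. x \<sqsubseteq> s"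
    using le_trans[OF _ inf_lower[OF assms(2)]] assms by (auto simp: subset_iff)
qed (use assms inf_greatest in blast)

lemma Sup_le_iff:
  assumes "x \<in> carrier L" "S \<subseteq> carrier L"
  shows "\<Squnion>S \<sqsubseteq> x \<longleftrightarrow> (\<forall>s\<in>S. s \<sqsubseteq> x)"
proof
  assume "\<Squnion>S \<sqsubseteq> x"
  then show "\<forall>s\<in>S. s \<sqsubseteq> x"
    using le_trans[OF sup_upper[OF assms(2)]] assms by (auto simp: subset_iff)
qed (use assms sup_least in blast)

lemma le_bottom_iff: "a \<in> carrier L \<Longrightarrow> a \<sqsubseteq> \<bottom> \<longleftrightarrow> a = \<bottom>"
  using le_antisym[of a \<bottom>] bottom_lower by auto

text \<open>Expanding \<open>c \<sqinter> (a \<squnion> b)\<close> by distributivity leaves only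
  \<open>c \<sqinter> b\<close>. Used in both directions this makes complements unique, so the
  definite description in \<open>mt_compl\<close> is meaningful.\<close>

lemma le_of_meet_bottom_join_top:
  assumes "a \<in> carrier L" "b \<in> carrier L" "c \<in> carrier L" "a \<sqinter> c = \<bottom>" "a \<squnion> b = \<top>"
  shows "c \<sqsubseteq> b"
proof -
  have "c = c \<sqinter> (a \<squnion> b)"
    using assms le_iff_join[OF assms(3) top_closed] by simp
  also have "\<dots> = (c \<sqinter> a) \<squnion> (c \<sqinter> b)" using assms meet_join_distrib by blast
  also have "\<dots> \<sqsubseteq> b"
    using assms by (simp add: join_le_iff meet_comm[of L c a] meet_right)
  finally show ?thesis .
qed

lemma compl:
  assumes "a \<in> carrier L"
  shows compl_closed [simp]: "mt_compl L a \<in> carrier L"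
    and meet_compl: "a \<sqinter> mt_compl L a = \<bottom>"
    and join_compl: "a \<squnion> mt_compl L a = \<top>"
proof -
  have "\<exists>!b. b \<in> carrier L \<and> a \<sqinter> b = \<bottom> \<and> a \<squnion> b = \<top>"
  proof (rule ex_ex1I)
    fix b c assume "b \<in> carrier L \<and> a \<sqinter> b = \<bottom> \<and> a \<squnion> b = \<top>" "c \<in> carrier L \<and> a \<sqinter> c = \<bottom> \<and> a \<squnion> c = \<top>"
    then show "b = c" using le_of_meet_bottom_join_top[of a b c] le_of_meet_bottom_join_top[of a c b] assms
      by (simp add: le_antisym)
  qed (use complemented[OF assms] in blast)
  from theI'[OF this] show "mt_compl L a \<in> carrier L" "a \<sqinter> mt_compl L a = \<bottom>"
    "a \<squnion> mt_compl L a = \<top>" by (auto simp: mt_compl_def)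
qed

lemma compl_unique:
  assumes "a \<in> carrier L" "b \<in> carrier L" "a \<sqinter> b = \<bottom>" "a \<squnion> b = \<top>"
  shows "mt_compl L a = b"
  using le_of_meet_bottom_join_top[of a b "mt_compl L a"]
    le_of_meet_bottom_join_top[of a "mt_compl L a" b] assms compl by (simp add: le_antisym)

lemma compl_compl[simp]: "a \<in> carrier L \<Longrightarrow> mt_compl L (mt_compl L a) = a"
  by (rule compl_unique) (simp_all add: compl join_comm[of L _ a] meet_comm[of L _ a])

lemma le_compl_iff:
  assumes "a \<in> carrier L" "b \<in> carrier L"
  shows "a \<sqsubseteq> mt_compl L b \<longleftrightarrow> a \<sqinter> b = \<bottom>"
proof
  assume "a \<sqsubseteq> mt_compl L b"
  then have "a \<sqinter> b \<sqsubseteq> b \<sqinter> mt_compl L b"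
    using le_trans[OF meet_left[of a b], of "mt_compl L b"] assms compl_closed
    by (simp add: le_meet_iff meet_right del: meet_compl)
  then show "a \<sqinter> b = \<bottom>" using assms meet_compl by (simp add: le_bottom_iff)
next
  assume "a \<sqinter> b = \<bottom>"
  then show "a \<sqsubseteq> mt_compl L b"
    using assms compl le_of_meet_bottom_join_top[of b "mt_compl L b" a] by (simp add: meet_comm)
qed

text \<open>Complementation forms an antitone Galois connection with itself, because disjointness is
  symmetric; order reversal and De Morgan are read off from this.\<close>

lemma le_compl_swap:
  assumes "a \<in> carrier L" "b \<in> carrier L"
  shows "a \<sqsubseteq> mt_compl L b \<longleftrightarrow> b \<sqsubseteq> mt_compl L a"
  using assms by (simp add: le_compl_iff meet_comm)

lemma compl_le_compl_iff:
  assumes "a \<in> carrier L" "b \<in> carrier L"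
  shows "mt_compl L a \<sqsubseteq> mt_compl L b \<longleftrightarrow> b \<sqsubseteq> a"
  using le_compl_swap[of "mt_compl L a" b] assms by (simp add: compl_closed compl_compl)

lemma compl_join:
  assumes "a \<in> carrier L" "b \<in> carrier L"
  shows "mt_compl L (a \<squnion> b) = mt_compl L a \<sqinter> mt_compl L b"
proof (rule le_antisym)
  have "a \<squnion> b \<sqsubseteq> mt_compl L (mt_compl L a \<sqinter> mt_compl L b)"
    using assms le_compl_swap[of a "mt_compl L a \<sqinter> mt_compl L b"]
      le_compl_swap[of b "mt_compl L a \<sqinter> mt_compl L b"]
    by (simp add: join_le_iff meet_left meet_right)
  moreover have "a \<squnion> b \<sqsubseteq> mt_compl L (mt_compl L a \<sqinter> mt_compl L b) \<longleftrightarrow> mt_compl L a \<sqinter> mt_compl L b \<sqsubseteq> mt_compl L (a \<squnion> b)"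
    using assms by (intro le_compl_swap) simp_all
  ultimately show "mt_compl L a \<sqinter> mt_compl L b \<sqsubseteq> mt_compl L (a \<squnion> b)" by blast
qed (use assms in \<open>simp_all add: compl_closed le_meet_iff compl_le_compl_iff join_left join_right\<close>)

lemma compl_top: "mt_compl L \<top> = \<bottom>"
  by (rule compl_unique) (use le_iff_join[of \<bottom> \<top>] le_iff_meet[of \<bottom> \<top>] in
      \<open>simp_all add: meet_comm[of L \<top>] join_comm[of L \<top>]\<close>)

lemma atomD:
  assumes "x \<in> mt_atoms L"
  shows "x \<in> carrier L" "x \<noteq> \<bottom>" "\<lbrakk>y \<in> carrier L; y \<sqsubseteq> x\<rbrakk> \<Longrightarrow> y = \<bottom> \<or> y = x"
  using assms by (auto simp: mt_atoms_def)

text \<open>The meet of an atom with \<open>a\<close> is bottom or the atom itself, so an atom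
  decides every element. Atoms thus behave like points even where they are too few to determine the
  elements.\<close>

lemma atom_le_compl_iff:
  assumes "x \<in> mt_atoms L" "a \<in> carrier L"
  shows "x \<sqsubseteq> mt_compl L a \<longleftrightarrow> \<not> x \<sqsubseteq> a"
proof -
  note x = atomD[OF assms(1)]
  have "x \<sqinter> a = \<bottom> \<or> x \<sqinter> a = x" using x(3)[of "x \<sqinter> a"] x(1) assms(2)
    by (simp add: meet_left)
  moreover have "x \<sqinter> a = x \<longleftrightarrow> x \<sqsubseteq> a" using le_iff_join[of x a] x(1) assms(2) by auto
  ultimately show ?thesis using x(1,2) assms(2) le_compl_iff by auto
qed

lemma atom_le_join_iff:
  assumes "x \<in> mt_atoms L" "a \<in> carrier L" "b \<in> carrier L"
  shows "x \<sqsubseteq> a \<squnion> b \<longleftrightarrow> x \<sqsubseteq> a \<or> x \<sqsubseteq> b"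
proof -
  note x = atomD[OF assms(1)]
  have "x \<sqsubseteq> mt_compl L a \<sqinter> mt_compl L b \<longleftrightarrow> \<not> (x \<sqsubseteq> a \<or> x \<sqsubseteq> b)"
    using assms x(1) by (simp add: atom_le_compl_iff le_meet_iff compl_closed)
  moreover have "mt_compl L (a \<squnion> b) = mt_compl L a \<sqinter> mt_compl L b"
    using assms by (simp add: compl_join)
  ultimately show ?thesis using atom_le_compl_iff[OF assms(1), of "a \<squnion> b"] assms by auto
qed

end

section \<open>Open elements and the space of atoms\<close>

context mt_algebra
begin

declare le_cong_l [rule del] le_cong_r [rule del] le_antisym [rule del] weak_refl [rule del]

section \<open>Interior, closure and saturation in an MT-algebra\<close>

lemma opens_closed: "u \<in> mt_opens M \<Longrightarrow> u \<in> carrier M"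
  by (simp add: mt_opens_def)

lemma opens_subset: "mt_opens M \<subseteq> carrier M"
  by (auto simp: mt_opens_def)

lemma box_open: "a \<in> carrier M \<Longrightarrow> \<box>a \<in> mt_opens M"
  using mbox_idem[of a] mbox_le[of "\<box>a"] mbox_closed
  by (simp add: mt_opens_def le_antisym)

lemma open_le_box_iff:
  assumes "u \<in> mt_opens M" "a \<in> carrier M"
  shows "u \<sqsubseteq> \<box>a \<longleftrightarrow> u \<sqsubseteq> a"
  using mbox_mono[of u a] le_trans[of u "\<box>a" a] mbox_le[of a] mbox_closed[of a] assms
  by (auto simp: mt_opens_def)

lemma top_open: "\<top> \<in> mt_opens M"
  by (simp add: mt_opens_def mbox_top)

text \<open>Trades the fixed point equation of the diamond for openness of the complement, the form
  in which closedness is used below.\<close>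

lemma closeds_iff: "c \<in> mt_closeds M \<longleftrightarrow> c \<in> carrier M \<and> mt_compl M c \<in> mt_opens M"
  unfolding mt_closeds_def mt_diamond_def mt_opens_def
  by (auto simp: mbox_closed) (metis compl_compl compl_closed mbox_closed)

lemma compl_open_closed: "u \<in> mt_opens M \<Longrightarrow> mt_compl M u \<in> mt_closeds M"
  by (simp add: closeds_iff opens_closed)

lemma closeds_closed: "c \<in> mt_closeds M \<Longrightarrow> c \<in> carrier M"
  by (simp add: closeds_iff)

lemma diamond_in_closeds: "a \<in> carrier M \<Longrightarrow> mt_diamond M a \<in> mt_closeds M"
  by (simp add: mt_diamond_def compl_open_closed box_open)

text \<open>Dual, through complements, of \<open>open_le_box_iff\<close>. Together they say that box
  and diamond are adjoint to the inclusions of the open and of the closed elements.\<close>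

lemma diamond_le_iff:
  assumes "a \<in> carrier M" "c \<in> mt_closeds M"
  shows "mt_diamond M a \<sqsubseteq> c \<longleftrightarrow> a \<sqsubseteq> c"
proof -
  have "mt_diamond M a \<sqsubseteq> c \<longleftrightarrow> mt_compl M c \<sqsubseteq> \<box>(mt_compl M a)"
    using compl_le_compl_iff[of "\<box>(mt_compl M a)" "mt_compl M c"] assms
    by (simp add: closeds_iff mt_diamond_def mbox_closed)
  also have "\<dots> \<longleftrightarrow> mt_compl M c \<sqsubseteq> mt_compl M a"
    using open_le_box_iff assms by (simp add: closeds_iff)
  finally show ?thesis using assms by (simp add: compl_le_compl_iff closeds_closed)
qed

lemma le_diamond: "a \<in> carrier M \<Longrightarrow> a \<sqsubseteq> mt_diamond M a"
  using diamond_le_iff[of a "mt_diamond M a"] diamond_in_closeds[of a] closeds_closed by simp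

lemma saturated_closed: "mt_saturated M a \<Longrightarrow> a \<in> carrier M"
  using opens_subset by (auto simp: mt_saturated_def)

lemma saturated_meet:
  assumes "mt_saturated M a" "mt_saturated M b"
  shows "mt_saturated M (a \<sqinter> b)"
proof -
  obtain S T where S: "S \<subseteq> mt_opens M" "a = \<Sqinter>S" and T: "T \<subseteq> mt_opens M" "b = \<Sqinter>T"
    using assms by (auto simp: mt_saturated_def)
  have c: "S \<subseteq> carrier M" "T \<subseteq> carrier M" using S T opens_subset by auto
  have "a \<sqinter> b = \<Sqinter>(S \<union> T)"
  proof (rule le_antisym)
    show "a \<sqinter> b \<sqsubseteq> \<Sqinter>(S \<union> T)"
      using c le_meet_iff[of "a \<sqinter> b" a b] le_Inf_iff[of "a \<sqinter> b"] S T by auto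
    show "\<Sqinter>(S \<union> T) \<sqsubseteq> a \<sqinter> b"
      using c le_Inf_iff[of "\<Sqinter>(S \<union> T)"] le_meet_iff[of "\<Sqinter>(S \<union> T)" a b] S T inf_lower[of "S \<union> T"] by auto
  qed (use S T c in auto)
  then show ?thesis using S T unfolding mt_saturated_def by (metis Un_least)
qed

lemma KS_iff: "k \<in> KS M \<longleftrightarrow> mt_compact M k \<and> mt_saturated M k"
  by (simp add: KS_def)

lemma KS_closed: "k \<in> KS M \<Longrightarrow> k \<in> carrier M"
  by (simp add: KS_def mt_compact_def)

section \<open>The map \<open>mt_eta M\<close> preserves the boolean operations\<close>

lemma mem_eta: "a \<in> carrier M \<Longrightarrow> x \<in> mt_eta M a \<longleftrightarrow> x \<in> mt_atoms M \<and> x \<sqsubseteq> a"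
  by (simp add: mt_eta_def)

lemma eta_subset: "a \<in> carrier M \<Longrightarrow> mt_eta M a \<subseteq> mt_atoms M"
  by (auto simp: mem_eta)

lemma eta_mono: "\<lbrakk>a \<in> carrier M; b \<in> carrier M; a \<sqsubseteq> b\<rbrakk> \<Longrightarrow> mt_eta M a \<subseteq> mt_eta M b"
  by (auto simp: mem_eta intro: le_trans[OF _ _ atomD(1)])

lemma eta_top: "mt_eta M \<top> = mt_atoms M"
  by (auto simp: mem_eta atomD(1))

lemma eta_bottom: "mt_eta M \<bottom> = {}"
  by (auto simp: mem_eta le_bottom_iff atomD(1,2))

text \<open>Atoms are completely join-prime by \<open>atom_le_Sup\<close>, which gives the inclusion
  from left to right; the other one is monotonicity.\<close>

lemma eta_Sup:
  assumes "S \<subseteq> carrier M"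
  shows "mt_eta M (\<Squnion>S) = \<Union>(mt_eta M ` S)"
proof (intro equalityI subsetI)
  fix x assume "x \<in> mt_eta M (\<Squnion>S)"
  then show "x \<in> \<Union>(mt_eta M ` S)"
    using atom_le_Sup[of x S] assms by (force simp: mem_eta subset_iff)
next
  fix x assume "x \<in> \<Union>(mt_eta M ` S)"
  then obtain s where "s \<in> S" "x \<in> mt_eta M s" by auto
  then show "x \<in> mt_eta M (\<Squnion>S)"
    using eta_mono[of s "\<Squnion>S"] sup_upper[of S s] assms by auto
qed

lemma eta_Inf:
  assumes "S \<subseteq> carrier M"
  shows "mt_eta M (\<Sqinter>S) = mt_atoms M \<inter> \<Inter>(mt_eta M ` S)"
  using assms by (auto simp: mem_eta le_Inf_iff atomD subset_iff)

lemma eta_join: "\<lbrakk>a \<in> carrier M; b \<in> carrier M\<rbrakk> \<Longrightarrow> mt_eta M (a \<squnion> b) = mt_eta M a \<union> mt_eta M b"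
  by (auto simp: mem_eta atom_le_join_iff)

lemma eta_meet: "\<lbrakk>a \<in> carrier M; b \<in> carrier M\<rbrakk> \<Longrightarrow> mt_eta M (a \<sqinter> b) = mt_eta M a \<inter> mt_eta M b"
  by (auto simp: mem_eta le_meet_iff atomD)

lemma eta_compl: "a \<in> carrier M \<Longrightarrow> mt_eta M (mt_compl M a) = mt_atoms M - mt_eta M a"
  by (auto simp: mem_eta atom_le_compl_iff)

section \<open>The topology on the atoms\<close>

lemma openin_at_iff: "openin (at_space M) U \<longleftrightarrow> (\<exists>u\<in>mt_opens M. U = mt_eta M u)"
  by (auto simp: at_space_def topology_inverse'[OF istopology_at])

lemma topspace_at: "topspace (at_space M) = mt_atoms M"
proof
  show "topspace (at_space M) \<subseteq> mt_atoms M"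
    using openin_topspace[of "at_space M"] eta_subset opens_closed unfolding openin_at_iff by blast
  show "mt_atoms M \<subseteq> topspace (at_space M)"
    using top_open eta_top by (intro openin_subset) (auto simp: openin_at_iff)
qed

lemma closedin_at_iff: "closedin (at_space M) C \<longleftrightarrow> (\<exists>c\<in>mt_closeds M. C = mt_eta M c)"
proof
  assume "closedin (at_space M) C"
  then obtain u where u: "u \<in> mt_opens M" "mt_atoms M - C = mt_eta M u" "C \<subseteq> mt_atoms M"
    by (auto simp: closedin_def openin_at_iff topspace_at)
  then have "C = mt_eta M (mt_compl M u)" by (auto simp: eta_compl opens_closed)
  then show "\<exists>c\<in>mt_closeds M. C = mt_eta M c" using u compl_open_closed by blast
next
  assume "\<exists>c\<in>mt_closeds M. C = mt_eta M c"
  then obtain c where "c \<in> mt_closeds M" "C = mt_eta M c" by auto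
  then show "closedin (at_space M) C"
    using eta_compl[of c] eta_subset[of c] by (auto simp: closedin_def openin_at_iff topspace_at closeds_iff)
qed

text \<open>Closed sets of atoms are the images of closed elements, and the diamond gives the least
  closed element above \<open>x\<close>; monotonicity of \<open>mt_eta M\<close> transports this
  minimality.\<close>

lemma closure_of_atom:
  assumes "x \<in> mt_atoms M"
  shows "at_space M closure_of {x} = mt_eta M (mt_diamond M x)"
proof (rule closure_of_unique)
  note x = atomD[OF assms]
  show "{x} \<subseteq> mt_eta M (mt_diamond M x)"
    using x le_diamond diamond_in_closeds assms by (simp add: mem_eta closeds_closed)
  show "closedin (at_space M) (mt_eta M (mt_diamond M x))"
    using diamond_in_closeds x by (auto simp: closedin_at_iff)
  fix T assume "{x} \<subseteq> T" "closedin (at_space M) T"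
  then obtain c where c: "c \<in> mt_closeds M" "T = mt_eta M c" "x \<in> mt_eta M c"
    by (auto simp: closedin_at_iff)
  then have "mt_diamond M x \<sqsubseteq> c" using x by (simp add: mem_eta closeds_closed diamond_le_iff)
  then show "mt_eta M (mt_diamond M x) \<subseteq> T"
    using c x by (simp add: eta_mono closeds_closed diamond_in_closeds)
qed

section \<open>Sobriety of the space of atoms\<close>

lemma T0_atom_eqI:
  assumes "mt_T0 M" "x \<in> mt_atoms M" "y \<in> mt_atoms M" "mt_diamond M x = mt_diamond M y"
  shows "x = y"
proof -
  note x = atomD[OF assms(2)] and y = atomD[OF assms(3)]
  have closed_iff: "x \<sqsubseteq> c \<longleftrightarrow> y \<sqsubseteq> c" if "c \<in> mt_closeds M" for c
    using that assms x(1) y(1) by (metis diamond_le_iff)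
  have open_iff: "x \<sqsubseteq> u \<longleftrightarrow> y \<sqsubseteq> u" if "u \<in> mt_opens M" for u
    using closed_iff[OF compl_open_closed[OF that]] assms opens_closed[OF that]
    by (simp add: atom_le_compl_iff)
  obtain S where S: "\<forall>s\<in>S. weakly_locally_closed M s" "x = \<Squnion>S"
    using assms x(1) unfolding mt_T0_def by blast
  have Sc: "S \<subseteq> carrier M"
    using S by (auto simp: weakly_locally_closed_def saturated_closed closeds_closed)
  obtain s where s: "s \<in> S" "x \<sqsubseteq> s"
    using atom_le_Sup[of x S] S Sc x assms by auto
  \<comment> \<open>The member \<open>s\<close> of the join lies above the atom \<open>x\<close>
    and, being a member, also below it; so \<open>x\<close> inherits the form of
    \<open>s\<close>.\<close>
  have "s = x" using s S Sc x(1) sup_upper[of S s] by (auto intro: le_antisym)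
  then obtain t c where tc: "mt_saturated M t" "c \<in> mt_closeds M" "x = t \<sqinter> c"
    using S s by (auto simp: weakly_locally_closed_def)
  have "x \<sqsubseteq> t" "x \<sqsubseteq> c"
    using tc le_meet_iff[of x t c] x(1) by (auto simp: saturated_closed closeds_closed)
  moreover have "y \<sqsubseteq> t" if "x \<sqsubseteq> t"
  proof -
    obtain U where "U \<subseteq> mt_opens M" "t = \<Sqinter>U" using tc by (auto simp: mt_saturated_def)
    then show ?thesis
      using that x(1) y(1) open_iff le_Inf_iff[of x U] le_Inf_iff[of y U] opens_subset by (auto simp: subset_iff)
  qed
  ultimately have "y \<sqsubseteq> x"
    using tc closed_iff y(1) by (simp add: le_meet_iff saturated_closed closeds_closed)
  then show ?thesis using x y by auto
qed

text \<open>Irreducibility of \<open>C\<close> is a statement about sets of atoms and has to be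
  lifted to a closed element representing \<open>C\<close>. An arbitrary representative need not be
  join-irreducible, but the least one is.\<close>

lemma sober_space_at:
  assumes "mt_sober M"
  shows "sober_space (at_space M)"
  unfolding sober_space_def
proof (intro allI impI)
  fix C assume C: "irreducible_closed_in (at_space M) C"
  \<comment> \<open>The join \<open>w\<close> of \<open>W\<close> is the largest open element with
    no atom in \<open>C\<close>, so its complement is the least closed element whose set of atoms is
    \<open>C\<close>.\<close>
  define W where "W = {u \<in> mt_opens M. mt_eta M u \<inter> C = {}}"
  define w where "w = \<Squnion>W"
  have w: "w \<in> mt_opens M" unfolding w_def by (rule mt_opens_Sup) (auto simp: W_def)
  have Wc: "W \<subseteq> carrier M" using opens_subset by (auto simp: W_def)
  have wC: "mt_eta M w \<inter> C = {}" unfolding w_def using Wc by (auto simp: eta_Sup W_def)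
  have CC: "C \<subseteq> mt_atoms M" using C closedin_subset[of "at_space M" C] by (simp add: irreducible_closed_in_def topspace_at)
  have le_w: "u \<sqsubseteq> w" if "u \<in> mt_opens M" "mt_eta M u \<inter> C = {}" for u
    unfolding w_def using that by (intro sup_upper[OF Wc]) (simp add: W_def)
  obtain c where c: "c \<in> mt_closeds M" "C = mt_eta M c"
    using C by (auto simp: irreducible_closed_in_def closedin_at_iff)
  have Cw: "C = mt_eta M (mt_compl M w)"
  proof
    show "C \<subseteq> mt_eta M (mt_compl M w)"
      using w wC CC by (auto simp: eta_compl opens_closed)
    have "mt_compl M c \<sqsubseteq> w"
      using c by (intro le_w) (auto simp: closeds_iff eta_compl)
    then have "mt_compl M w \<sqsubseteq> c"
      using compl_le_compl_iff[of w "mt_compl M c"] c w by (simp add: closeds_closed opens_closed)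
    then show "mt_eta M (mt_compl M w) \<subseteq> C"
      using c w by (simp add: eta_mono closeds_closed opens_closed)
  qed
  \<comment> \<open>Minimality of the representative: among closed elements below it, equality of
    the sets of atoms already forces equality. This turns a decomposition of \<open>C\<close> into
    one of the element.\<close>
  have eq: "mt_compl M w = a"
    if "a \<in> mt_closeds M" "a \<sqsubseteq> mt_compl M w" "C = mt_eta M a" for a
  proof -
    have "mt_compl M a \<sqsubseteq> w"
      using that by (intro le_w) (auto simp: closeds_iff eta_compl)
    then have "mt_compl M w \<sqsubseteq> a"
      using compl_le_compl_iff[of w "mt_compl M a"] that w by (simp add: closeds_closed opens_closed)
    then show ?thesis using that w by (simp add: le_antisym closeds_closed opens_closed)
  qed
  have "join_irreducible_closed M (mt_compl M w)"
    unfolding join_irreducible_closed_def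
  proof (intro conjI ballI impI)
    show "mt_compl M w \<in> mt_closeds M" using w by (rule compl_open_closed)
    show "mt_compl M w \<noteq> \<bottom>"
      using C Cw eta_bottom by (auto simp: irreducible_closed_in_def)
    fix a b assume ab: "a \<in> mt_closeds M" "b \<in> mt_closeds M" "mt_compl M w = a \<squnion> b"
    then have abc: "a \<in> carrier M" "b \<in> carrier M" by (auto simp: closeds_closed)
    have "C = mt_eta M a \<union> mt_eta M b" using Cw ab abc by (simp add: eta_join)
    moreover have "closedin (at_space M) (mt_eta M a)" "closedin (at_space M) (mt_eta M b)"
      using ab by (auto simp: closedin_at_iff)
    ultimately have "C = mt_eta M a \<or> C = mt_eta M b"
      using C unfolding irreducible_closed_in_def by blast
    then show "mt_compl M w = a \<or> mt_compl M w = b"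
      using eq[of a] eq[of b] ab abc by (auto simp: join_left join_right)
  qed
  then obtain x where x: "x \<in> mt_atoms M" "mt_compl M w = mt_diamond M x"
    using assms by (auto simp: mt_sober_def)
  \<comment> \<open>The diamond of another generic point \<open>y\<close> also represents
    \<open>C\<close> and lies below the least representative, so it equals the diamond of
    \<open>x\<close>.\<close>
  have "y = x" if y: "y \<in> mt_atoms M" "C = at_space M closure_of {y}" for y
  proof -
    have "C = mt_eta M (mt_diamond M y)" using closure_of_atom y by simp
    moreover have "y \<in> mt_eta M (mt_diamond M y)"
      using y by (simp add: mem_eta closeds_closed diamond_in_closeds le_diamond atomD(1))
    then have "y \<in> C" using calculation by simp
    then have "y \<sqsubseteq> mt_compl M w" using Cw w by (simp add: mem_eta opens_closed)
    then have "mt_diamond M y \<sqsubseteq> mt_compl M w"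
      using w y by (simp add: diamond_le_iff atomD(1) compl_open_closed)
    ultimately have "mt_compl M w = mt_diamond M y"
      using eq y by (simp add: diamond_in_closeds atomD(1))
    then show ?thesis using T0_atom_eqI x y assms by (simp add: mt_sober_def)
  qed
  then show "\<exists>!x. x \<in> topspace (at_space M) \<and> C = at_space M closure_of {x}"
    using x Cw closure_of_atom[OF x(1)] topspace_at by (intro ex1I[of _ x]) auto
qed

section \<open>Compact saturated elements and compact saturated sets of atoms\<close>

lemma eta_saturated:
  assumes "mt_saturated M a"
  shows "saturated_in (at_space M) (mt_eta M a)"
proof -
  obtain S where S: "S \<subseteq> mt_opens M" "a = \<Sqinter>S" using assms by (auto simp: mt_saturated_def)
  then have "mt_eta M a = topspace (at_space M) \<inter> \<Inter>(mt_eta M ` S)"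
    using eta_Inf opens_subset by (auto simp: topspace_at)
  moreover have "\<forall>U\<in>mt_eta M ` S. openin (at_space M) U"
    using S by (auto simp: openin_at_iff)
  ultimately show ?thesis unfolding saturated_in_def by blast
qed

text \<open>
  The algebraic core of the Hofmann--Mislove theorem. If \<open>k\<close> is not below \<open>u\<close>, Zorn's lemma yields
  an open \<open>v\<close> maximal among those above \<open>u\<close> but not above \<open>k\<close>; its complement is join-irreducible,
  hence the closure of an atom, and this atom is below \<open>k\<close> (as \<open>k\<close> is saturated) but not below \<open>u\<close>.
\<close>

lemma compact_saturated_le_openI:
  assumes sober: "mt_sober M" and k: "k \<in> KS M" and u: "u \<in> mt_opens M"
    and sub: "mt_eta M k \<subseteq> mt_eta M u"
  shows "k \<sqsubseteq> u"
proof (rule ccontr)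
  assume nle: "\<not> k \<sqsubseteq> u"
  have kc: "k \<in> carrier M" using k by (rule KS_closed)
  define A where "A = {v \<in> mt_opens M. u \<sqsubseteq> v \<and> \<not> k \<sqsubseteq> v}"
  have Ac: "A \<subseteq> carrier M" using opens_subset by (auto simp: A_def)
  have refl: "a \<sqsubseteq> a" if "a \<in> A" for a using that Ac by auto
  have "\<exists>v\<in>A. \<forall>a\<in>A. v \<sqsubseteq> a \<longrightarrow> a = v"
  proof -
    \<comment> \<open>Zorn's lemma is applied to a relation whose field is \<open>A\<close>, so the
      order is cut down to \<open>A\<close>.\<close>
    define r where "r = {(a, b). a \<in> A \<and> b \<in> A \<and> a \<sqsubseteq> b}"
    have F: "Field r = A" using refl by (auto simp: r_def Field_def)
    have "Partial_order r"
      unfolding partial_order_on_def preorder_on_def F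
    proof (intro conjI)
      show "refl_on A r" "r \<subseteq> A \<times> A" using refl by (auto simp: r_def refl_on_def)
      show "trans r"
      proof (rule transI)
        fix a b c assume "(a, b) \<in> r" "(b, c) \<in> r"
        then show "(a, c) \<in> r" using Ac le_trans[of a b c] by (auto simp: r_def)
      qed
      show "antisym r"
      proof (rule antisymI)
        fix a b assume "(a, b) \<in> r" "(b, a) \<in> r"
        then show "a = b" using Ac le_antisym[of a b] by (auto simp: r_def)
      qed
    qed
    moreover have "\<exists>v\<in>Field r. \<forall>a\<in>C. (a, v) \<in> r" if C: "C \<in> Chains r" for C
    proof (cases "C = {}")
      case True
      then show ?thesis using u nle opens_closed F by (auto simp: A_def)
    next
      case False
      have CA: "C \<subseteq> A" using C by (force simp: Chains_def r_def)
      then have Cc: "C \<subseteq> carrier M" using Ac by auto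
      have Co: "C \<subseteq> mt_opens M" using CA by (auto simp: A_def)
      \<comment> \<open>A finite part of a chain is bounded by one member, so a finite subcover from
        \<open>C\<close> shrinks to a single element of \<open>A\<close>. For the empty part,
        \<open>C\<close> being nonempty supplies the bound.\<close>
      have fin: "\<exists>v\<in>C. \<forall>t\<in>T. t \<sqsubseteq> v" if "finite T" "T \<subseteq> C" for T
        using that
      proof (induction T)
        case empty then show ?case using False by auto
      next
        case (insert t T)
        then obtain v where v: "v \<in> C" "\<forall>t\<in>T. t \<sqsubseteq> v" by auto
        have "(t, v) \<in> r \<or> (v, t) \<in> r" using C insert v by (auto simp: Chains_def)
        then consider "t \<sqsubseteq> v" | "v \<sqsubseteq> t" by (auto simp: r_def)
        then show ?case
        proof cases
          case 1 then show ?thesis using v by auto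
        next
          case 2
          have "\<forall>s\<in>insert t T. s \<sqsubseteq> t"
            using v 2 insert Cc le_trans[OF _ 2] by (auto simp: subset_iff)
          then show ?thesis using insert by auto
        qed
      qed
      have "\<not> k \<sqsubseteq> \<Squnion>C"
      proof
        assume "k \<sqsubseteq> \<Squnion>C"
        then obtain T where T: "T \<subseteq> C" "finite T" "k \<sqsubseteq> \<Squnion>T"
          using k Co unfolding KS_iff mt_compact_def by blast
        then obtain v where v: "v \<in> C" "\<forall>t\<in>T. t \<sqsubseteq> v" using fin[of T] by auto
        then have "\<Squnion>T \<sqsubseteq> v" using T Cc by (intro sup_least) auto
        then have "k \<sqsubseteq> v" using T v Cc kc le_trans[OF T(3)] by auto
        then show False using v CA by (auto simp: A_def)
      qed
      moreover have "u \<sqsubseteq> \<Squnion>C"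
      proof -
        obtain v where "v \<in> C" using False by auto
        then show ?thesis
          using le_trans[of u v "\<Squnion>C"] sup_upper[OF Cc] CA Cc u by (auto simp: A_def opens_closed)
      qed
      ultimately have "\<Squnion>C \<in> A" using mt_opens_Sup[OF Co] by (simp add: A_def)
      then show ?thesis
        using CA sup_upper[OF Cc] F by (intro bexI[of _ "\<Squnion>C"]) (auto simp: r_def)
    qed
    ultimately obtain v where "v \<in> Field r" "\<forall>a\<in>Field r. (v, a) \<in> r \<longrightarrow> a = v"
      using Zorns_po_lemma[of r] by auto
    then show ?thesis unfolding F by (auto simp: r_def)
  qed
  then obtain v where v: "v \<in> mt_opens M" "u \<sqsubseteq> v" "\<not> k \<sqsubseteq> v"
    and max: "\<And>a. \<lbrakk>a \<in> mt_opens M; u \<sqsubseteq> a; \<not> k \<sqsubseteq> a; v \<sqsubseteq> a\<rbrakk> \<Longrightarrow> a = v"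
    by (auto simp: A_def)
  have vc: "v \<in> carrier M" and uc: "u \<in> carrier M" using v u by (auto simp: opens_closed)
  \<comment> \<open>Maximality in usable form: an open element strictly above \<open>v\<close> is
    automatically above \<open>u\<close>, hence can stay outside \<open>A\<close> only by being
    above \<open>k\<close>.\<close>
  have above: "k \<sqsubseteq> a" if "a \<in> mt_opens M" "v \<sqsubseteq> a" "a \<noteq> v" for a
    using max[of a] that le_trans[OF v(2) that(2)] uc vc by (auto simp: opens_closed)
  have "join_irreducible_closed M (mt_compl M v)"
    unfolding join_irreducible_closed_def
  proof (intro conjI ballI impI)
    show "mt_compl M v \<in> mt_closeds M" using v by (simp add: compl_open_closed)
    show "mt_compl M v \<noteq> \<bottom>"
    proof
      assume "mt_compl M v = \<bottom>"
      then have "v = \<top>" using vc compl_compl[of v] compl_compl[of \<top>] compl_top by simp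
      then show False using v kc by simp
    qed
    fix a b assume ab: "a \<in> mt_closeds M" "b \<in> mt_closeds M" "mt_compl M v = a \<squnion> b"
    have abc: "a \<in> carrier M" "b \<in> carrier M" using ab by (auto simp: closeds_closed)
    have v_eq: "v = mt_compl M a \<sqinter> mt_compl M b"
      using ab(3) abc vc compl_compl[of v] by (simp add: compl_join)
    show "mt_compl M v = a \<or> mt_compl M v = b"
    proof (rule ccontr)
      assume "\<not> ?thesis"
      \<comment> \<open>Both complements are open and strictly above \<open>v\<close>, hence above
        \<open>k\<close>; so is their meet, which is \<open>v\<close>.\<close>
      then have "mt_compl M a \<noteq> v" "mt_compl M b \<noteq> v" using abc by auto
      then have "k \<sqsubseteq> mt_compl M a" "k \<sqsubseteq> mt_compl M b"
        using v_eq ab abc meet_left meet_right by (auto simp: closeds_iff intro!: above)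
      then show False using v v_eq kc abc by (simp add: le_meet_iff)
    qed
  qed
  then obtain x where x: "x \<in> mt_atoms M" "mt_compl M v = mt_diamond M x"
    using sober by (auto simp: mt_sober_def)
  have xc: "x \<in> carrier M" using x atomD by auto
  have "x \<sqsubseteq> mt_compl M v" using x xc le_diamond by simp
  then have "\<not> x \<sqsubseteq> v" using atom_le_compl_iff[OF x(1) vc] by simp
  then have "\<not> x \<sqsubseteq> u" using le_trans[OF _ v(2)] xc uc vc by auto
  obtain S where S: "S \<subseteq> mt_opens M" "k = \<Sqinter>S" using k by (auto simp: KS_iff mt_saturated_def)
  \<comment> \<open>An open element not above \<open>x\<close> lies below \<open>v\<close>, because
    the complement of \<open>v\<close> is the least closed element above \<open>x\<close>. No
    generator of \<open>k\<close> does, since \<open>k\<close> would then be below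
    \<open>v\<close>.\<close>
  have "x \<sqsubseteq> s" if "s \<in> S" for s
  proof (rule ccontr)
    assume "\<not> x \<sqsubseteq> s"
    have s: "s \<in> mt_opens M" "s \<in> carrier M" using that S opens_subset by auto
    then have "x \<sqsubseteq> mt_compl M s" using \<open>\<not> x \<sqsubseteq> s\<close> x by (simp add: atom_le_compl_iff)
    then have "mt_compl M v \<sqsubseteq> mt_compl M s"
      using x xc s by (simp add: diamond_le_iff compl_open_closed)
    then have "s \<sqsubseteq> v" using s vc by (simp add: compl_le_compl_iff)
    moreover have "k \<sqsubseteq> s" using S that inf_lower opens_subset by auto
    ultimately show False using v(3) le_trans[of k s v] kc vc s by simp
  qed
  then have "x \<sqsubseteq> k" using S xc le_Inf_iff[of x S] opens_subset by auto
  then show False using sub x kc uc \<open>\<not> x \<sqsubseteq> u\<close> by (auto simp: mem_eta)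
qed

text \<open>An open cover of \<open>mt_eta M k\<close> is the image of a family of open elements.
  The separation lemma \<open>compact_saturated_le_openI\<close> turns the inclusion of atoms into
  an inequality in \<open>M\<close>, where compactness of \<open>k\<close> applies.\<close>

lemma eta_compactin:
  assumes sober: "mt_sober M" and k: "k \<in> KS M"
  shows "compactin (at_space M) (mt_eta M k)"
  unfolding compactin_def
proof (intro conjI allI impI)
  show "mt_eta M k \<subseteq> topspace (at_space M)" using k by (simp add: topspace_at eta_subset KS_closed)
  fix \<U> assume U: "(\<forall>U\<in>\<U>. openin (at_space M) U) \<and> mt_eta M k \<subseteq> \<Union>\<U>"
  then have "\<U> \<subseteq> mt_eta M ` mt_opens M" by (auto simp: openin_at_iff)
  then obtain S where S: "S \<subseteq> mt_opens M" "\<U> = mt_eta M ` S" by (auto simp: subset_image_iff)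
  have Sc: "S \<subseteq> carrier M" using S opens_subset by auto
  have "mt_eta M k \<subseteq> mt_eta M (\<Squnion>S)" using U S Sc by (simp add: eta_Sup)
  then have "k \<sqsubseteq> \<Squnion>S"
    using compact_saturated_le_openI sober k mt_opens_Sup S by blast
  then obtain T where T: "T \<subseteq> S" "finite T" "k \<sqsubseteq> \<Squnion>T"
    using k S unfolding KS_iff mt_compact_def by blast
  then have "mt_eta M k \<subseteq> \<Union>(mt_eta M ` T)"
    using eta_mono[of k "\<Squnion>T"] eta_Sup[of T] k Sc by (simp add: KS_closed subset_trans[OF T(1) Sc])
  then show "\<exists>\<F>. finite \<F> \<and> \<F> \<subseteq> \<U> \<and> mt_eta M k \<subseteq> \<Union>\<F>"
    using T S by (intro exI[of _ "mt_eta M ` T"]) auto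
qed

lemma compact_saturated_in_at:
  assumes K: "compactin (at_space M) K" "saturated_in (at_space M) K"
  shows "\<exists>k\<in>KS M. K = mt_eta M k"
proof -
  \<comment> \<open>The family is as large as possible: besides generating a saturated element with
    image \<open>K\<close>, it contains the join of every finite subcover of \<open>K\<close>, which
    makes \<open>k\<close> compact.\<close>
  define S where "S = {u \<in> mt_opens M. K \<subseteq> mt_eta M u}"
  define k where "k = \<Sqinter>S"
  have Sc: "S \<subseteq> carrier M" using opens_subset by (auto simp: S_def)
  then have kc: "k \<in> carrier M" by (simp add: k_def)
  have sat: "mt_saturated M k" unfolding mt_saturated_def k_def by (rule exI[of _ S]) (auto simp: S_def)
  have KA: "K \<subseteq> mt_atoms M" using compactin_subset_topspace[OF K(1)] topspace_at by simp
  have eta_k: "mt_eta M k = mt_atoms M \<inter> \<Inter>(mt_eta M ` S)"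
    using Sc by (simp add: k_def eta_Inf)
  have K_eq: "K = mt_eta M k"
  proof
    show "K \<subseteq> mt_eta M k" using KA eta_k by (auto simp: S_def)
    obtain \<U> where U: "\<forall>U\<in>\<U>. openin (at_space M) U" "K = mt_atoms M \<inter> \<Inter>\<U>"
      using K(2) by (auto simp: saturated_in_def topspace_at)
    have "\<U> \<subseteq> mt_eta M ` S"
      using U by (force simp: openin_at_iff S_def)
    then show "mt_eta M k \<subseteq> K" using eta_k U(2) by auto
  qed
  have "mt_compact M k"
    unfolding mt_compact_def
  proof (intro conjI allI impI kc)
    fix V assume V: "V \<subseteq> mt_opens M" "k \<sqsubseteq> \<Squnion>V"
    have Vc: "V \<subseteq> carrier M" using V opens_subset by auto
    have "K \<subseteq> \<Union>(mt_eta M ` V)"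
      using eta_mono[OF kc _ V(2)] Vc K_eq eta_Sup[OF Vc] by simp
    moreover have "\<forall>U\<in>mt_eta M ` V. openin (at_space M) U"
      using V by (auto simp: openin_at_iff)
    ultimately obtain \<F> where F: "finite \<F>" "\<F> \<subseteq> mt_eta M ` V" "K \<subseteq> \<Union>\<F>"
      using K(1) unfolding compactin_def by meson
    then obtain T where T: "T \<subseteq> V" "finite T" "\<F> = mt_eta M ` T"
      by (meson finite_subset_image)
    have "K \<subseteq> mt_eta M (\<Squnion>T)" using F T Vc eta_Sup[of T] by auto
    then have "\<Squnion>T \<in> S" using mt_opens_Sup T V by (auto simp: S_def)
    then have "k \<sqsubseteq> \<Squnion>T" unfolding k_def by (rule inf_lower[OF Sc])
    then show "\<exists>T\<subseteq>V. finite T \<and> k \<sqsubseteq> \<Squnion>T" using T by auto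
  qed
  then show ?thesis using K_eq sat by (auto simp: KS_iff)
qed

text \<open>An element and its saturation lie below the same open elements, so saturating preserves
  compactness. It serves to replace the merely compact interpolant in \<open>compactly_below\<close>
  by a member of \<open>KS M\<close>, whose image is known to be compact.\<close>

lemma compact_le_KS_le_open:
  assumes k: "mt_compact M k" and u: "u \<in> mt_opens M" and "k \<sqsubseteq> u"
  shows "\<exists>s\<in>KS M. k \<sqsubseteq> s \<and> s \<sqsubseteq> u"
proof -
  define S where "S = {v \<in> mt_opens M. k \<sqsubseteq> v}"
  define s where "s = \<Sqinter>S"
  have Sc: "S \<subseteq> carrier M" using opens_subset by (auto simp: S_def)
  have kc: "k \<in> carrier M" using k by (simp add: mt_compact_def)
  have sc: "s \<in> carrier M" using Sc by (simp add: s_def)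
  have ks: "k \<sqsubseteq> s" using kc Sc by (simp add: s_def le_Inf_iff) (simp add: S_def)
  have su: "s \<sqsubseteq> v" if "v \<in> mt_opens M" "k \<sqsubseteq> v" for v
    unfolding s_def using that by (intro inf_lower[OF Sc]) (simp add: S_def)
  have "mt_compact M s"
    unfolding mt_compact_def
  proof (intro conjI allI impI sc)
    fix V assume V: "V \<subseteq> mt_opens M" "s \<sqsubseteq> \<Squnion>V"
    then have Vc: "V \<subseteq> carrier M" using opens_subset by auto
    have "k \<sqsubseteq> \<Squnion>V" using le_trans[OF ks V(2)] kc sc Vc by simp
    then obtain T where T: "T \<subseteq> V" "finite T" "k \<sqsubseteq> \<Squnion>T"
      using k V unfolding mt_compact_def by blast
    then have "s \<sqsubseteq> \<Squnion>T" using V by (intro su mt_opens_Sup) auto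
    then show "\<exists>T\<subseteq>V. finite T \<and> s \<sqsubseteq> \<Squnion>T" using T by blast
  qed
  moreover have "mt_saturated M s" unfolding mt_saturated_def s_def by (rule exI[of _ S]) (auto simp: S_def)
  ultimately show ?thesis using ks su assms by (auto simp: KS_iff)
qed

lemma stably_compact_space_at:
  assumes "mt_stably_compact M"
  shows "stably_compact_space (at_space M)"
  unfolding stably_compact_space_def
proof (intro conjI allI impI)
  have M: "mt_locally_compact M" "mt_sober M" "mt_compact M \<top>"
    "\<And>k m. \<lbrakk>k \<in> KS M; m \<in> KS M\<rbrakk> \<Longrightarrow> k \<sqinter> m \<in> KS M"
    using assms by (auto simp: mt_stably_compact_def mt_stably_locally_compact_def)
  show "sober_space (at_space M)" using M by (simp add: sober_space_at)
  \<comment> \<open>Compactness of the space comes from viewing the top element as a member of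
    \<open>KS M\<close>.\<close>
  have "mt_saturated M \<top>" unfolding mt_saturated_def
    using top_open by (intro exI[of _ "{\<top>}"]) simp
  then have "compactin (at_space M) (mt_eta M \<top>)"
    using M by (intro eta_compactin) (auto simp: KS_iff)
  then show "compact_space (at_space M)" by (simp add: compact_space_def topspace_at eta_top)
  show "neighbourhood_base_of (compactin (at_space M)) (at_space M)"
    unfolding neighbourhood_base_of
  proof (intro allI impI)
    fix W x assume "openin (at_space M) W \<and> x \<in> W"
    then obtain w where w: "w \<in> mt_opens M" "W = mt_eta M w" "x \<in> mt_eta M w"
      by (auto simp: openin_at_iff)
    let ?V = "{v \<in> mt_opens M. compactly_below M v w}"
    have "w = \<Squnion>?V" using M(1) w by (simp add: mt_locally_compact_def)
    moreover have "?V \<subseteq> carrier M" using opens_subset by auto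
    ultimately have "x \<in> \<Union>(mt_eta M ` ?V)" using eta_Sup[of ?V] w(3) by simp
    then obtain v where v: "v \<in> mt_opens M" "compactly_below M v w" "x \<in> mt_eta M v" by auto
    then obtain k where k: "mt_compact M k" "v \<sqsubseteq> k" "k \<sqsubseteq> w" by (auto simp: compactly_below_def)
    obtain s where s: "s \<in> KS M" "k \<sqsubseteq> s" "s \<sqsubseteq> w"
      using compact_le_KS_le_open[OF k(1) w(1) k(3)] by auto
    have kc: "k \<in> carrier M" using k by (simp add: mt_compact_def)
    have vs: "v \<sqsubseteq> s" using le_trans[OF k(2) s(2)] v s kc by (simp add: opens_closed KS_closed)
    have "x \<in> mt_eta M v" "mt_eta M v \<subseteq> mt_eta M s" "mt_eta M s \<subseteq> W"
      using v(1,3) w(1,2) s vs by (simp_all add: eta_mono opens_closed KS_closed)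
    moreover have "openin (at_space M) (mt_eta M v)" "compactin (at_space M) (mt_eta M s)"
      using v(1) openin_at_iff eta_compactin[OF M(2) s(1)] by auto
    ultimately show "\<exists>U V. openin (at_space M) U \<and> compactin (at_space M) V \<and> x \<in> U \<and> U \<subseteq> V \<and> V \<subseteq> W"
      by blast
  qed
  fix K L assume "compactin (at_space M) K \<and> saturated_in (at_space M) K \<and>
    compactin (at_space M) L \<and> saturated_in (at_space M) L"
  \<comment> \<open>Both sets lift to \<open>KS M\<close>, where the meet stays by assumption, and
    \<open>mt_eta M\<close> turns that meet into the intersection.\<close>
  then obtain k l where kl: "k \<in> KS M" "l \<in> KS M" "K = mt_eta M k" "L = mt_eta M l"
    using compact_saturated_in_at by blast
  then have "K \<inter> L = mt_eta M (k \<sqinter> l)" by (simp add: eta_meet KS_closed)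
  then show "compactin (at_space M) (K \<inter> L)" using M kl by (simp add: eta_compactin)
qed

end

section \<open>Powerset algebras\<close>

lemma pow_simps [simp]:
  "carrier (pow_mt X) = Pow (topspace X)"
  "eq (pow_mt X) = (=)"
  "le (pow_mt X) = (\<subseteq>)"
  "mbox (pow_mt X) = (\<lambda>A. X interior_of A)"
  by (simp_all add: pow_mt_def)

lemma complete_lattice_pow: "Complete_Lattice.complete_lattice (pow_mt X)"
proof -
  have "\<exists>s. least (pow_mt X) s (Upper (pow_mt X) \<A>)" if "\<A> \<subseteq> Pow (topspace X)" for \<A>
    using that by (intro exI[of _ "\<Union>\<A>"]) (auto simp: least_def Upper_def; blast)
  moreover have "\<exists>i. greatest (pow_mt X) i (Lower (pow_mt X) \<A>)" if "\<A> \<subseteq> Pow (topspace X)" for \<A>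
    \<comment> \<open>The intersection with the whole space matters for the empty family, whose meet
      must be the top.\<close>
    using that by (intro exI[of _ "topspace X \<inter> \<Inter>\<A>"]) (auto simp: greatest_def Lower_def; blast)
  ultimately show ?thesis
    by unfold_locales auto
qed

context
  fixes X :: "'a topology"
begin

interpretation pow: Complete_Lattice.complete_lattice "pow_mt X"
  by (rule complete_lattice_pow)

lemma pow_Sup: "\<A> \<subseteq> Pow (topspace X) \<Longrightarrow> \<Squnion>\<^bsub>pow_mt X\<^esub>\<A> = \<Union>\<A>"
  using pow.sup_least[of \<A> "\<Union>\<A>"] pow.sup_upper[of \<A>] by (simp add: Sup_le_iff set_eq_subset) blast

lemma pow_Inf: "\<A> \<subseteq> Pow (topspace X) \<Longrightarrow> \<Sqinter>\<^bsub>pow_mt X\<^esub>\<A> = topspace X \<inter> \<Inter>\<A>"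
  using pow.inf_greatest[of \<A> "topspace X \<inter> \<Inter>\<A>"] pow.inf_lower[of \<A>] pow.inf_closed[of \<A>]
  by (simp add: set_eq_subset) blast

lemma pow_join: "\<lbrakk>A \<subseteq> topspace X; B \<subseteq> topspace X\<rbrakk> \<Longrightarrow> A \<squnion>\<^bsub>pow_mt X\<^esub> B = A \<union> B"
  by (simp add: join_def pow_Sup)

lemma pow_meet: "\<lbrakk>A \<subseteq> topspace X; B \<subseteq> topspace X\<rbrakk> \<Longrightarrow> A \<sqinter>\<^bsub>pow_mt X\<^esub> B = A \<inter> B"
  by (auto simp: meet_def pow_Inf)

lemma pow_top [simp]: "\<top>\<^bsub>pow_mt X\<^esub> = topspace X"
  using pow.top_higher[of "topspace X"] pow.top_closed by simp

lemma pow_bottom [simp]: "\<bottom>\<^bsub>pow_mt X\<^esub> = {}"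
  using pow.bottom_lower[of "{}"] by simp

end

lemma mt_algebra_pow: "mt_algebra (pow_mt X)"
proof -
  interpret pow: Complete_Lattice.complete_lattice "pow_mt X"
    by (rule complete_lattice_pow)
  show ?thesis
  proof
    fix A assume A: "A \<in> carrier (pow_mt X)"
    then have "A \<sqinter>\<^bsub>pow_mt X\<^esub> (topspace X - A) = {}" "A \<squnion>\<^bsub>pow_mt X\<^esub> (topspace X - A) = topspace X"
      by (auto simp: pow_meet pow_join)
    then show "\<exists>B\<in>carrier (pow_mt X). A \<sqinter>\<^bsub>pow_mt X\<^esub> B = \<bottom>\<^bsub>pow_mt X\<^esub> \<and> A \<squnion>\<^bsub>pow_mt X\<^esub> B = \<top>\<^bsub>pow_mt X\<^esub>"
      by (intro bexI[of _ "topspace X - A"]) auto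
  next
    fix A B C assume "A \<in> carrier (pow_mt X)" "B \<in> carrier (pow_mt X)" "C \<in> carrier (pow_mt X)"
    then show "A \<sqinter>\<^bsub>pow_mt X\<^esub> (B \<squnion>\<^bsub>pow_mt X\<^esub> C) =
      (A \<sqinter>\<^bsub>pow_mt X\<^esub> B) \<squnion>\<^bsub>pow_mt X\<^esub> (A \<sqinter>\<^bsub>pow_mt X\<^esub> C)"
      by (simp add: pow_join pow_meet le_infI1 Int_Un_distrib)
  next
    fix A B assume "A \<in> carrier (pow_mt X)" "B \<in> carrier (pow_mt X)"
    then show "\<box>\<^bsub>pow_mt X\<^esub>(A \<sqinter>\<^bsub>pow_mt X\<^esub> B) = \<box>\<^bsub>pow_mt X\<^esub>A \<sqinter>\<^bsub>pow_mt X\<^esub> \<box>\<^bsub>pow_mt X\<^esub>B"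
      by (simp add: pow_meet interior_of_Int interior_of_subset_topspace)
  qed (simp_all add: interior_of_subset interior_of_subset_topspace)
qed

context
  fixes X :: "'a topology"
begin

interpretation pow: mt_algebra "pow_mt X"
  by (rule mt_algebra_pow)

lemma pow_compl: "A \<subseteq> topspace X \<Longrightarrow> mt_compl (pow_mt X) A = topspace X - A"
  by (rule pow.compl_unique) (auto simp: pow_meet pow_join)

lemma pow_opens: "mt_opens (pow_mt X) = {U. openin X U}"
  by (auto simp: mt_opens_def interior_of_eq dest: openin_subset)

lemma pow_closeds: "mt_closeds (pow_mt X) = {C. closedin X C}"
  by (auto simp: pow.closeds_iff pow_compl pow_opens closedin_def)

lemma pow_diamond: "A \<subseteq> topspace X \<Longrightarrow> mt_diamond (pow_mt X) A = X closure_of A"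
  by (simp add: mt_diamond_def pow_compl interior_of_subset_topspace interior_of_complement
      double_diff closure_of_subset_topspace)

lemma pow_atoms: "mt_atoms (pow_mt X) = (\<lambda>x. {x}) ` topspace X"
proof (intro equalityI subsetI)
  fix A assume A: "A \<in> mt_atoms (pow_mt X)"
  then obtain x where x: "x \<in> A" "A \<subseteq> topspace X" by (auto simp: mt_atoms_def)
  then have "{x} = A" using A by (auto simp: mt_atoms_def)
  then show "A \<in> (\<lambda>x. {x}) ` topspace X" using x by auto
qed (auto simp: mt_atoms_def)

lemma pow_eta: "A \<subseteq> topspace X \<Longrightarrow> mt_eta (pow_mt X) A = (\<lambda>x. {x}) ` A"
  by (auto simp: pow.mem_eta pow_atoms image_iff)

lemma pow_saturated_iff: "mt_saturated (pow_mt X) S \<longleftrightarrow> saturated_in X S"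
proof -
  have "\<Sqinter>\<^bsub>pow_mt X\<^esub>\<U> = topspace X \<inter> \<Inter>\<U>" if "\<forall>U\<in>\<U>. openin X U" for \<U>
    using that openin_subset by (intro pow_Inf) auto
  then show ?thesis
    unfolding mt_saturated_def saturated_in_def pow_opens by (metis mem_Collect_eq subset_iff)
qed

lemma pow_compact_iff: "mt_compact (pow_mt X) K \<longleftrightarrow> compactin X K"
proof -
  have Sup: "\<Squnion>\<^bsub>pow_mt X\<^esub>\<U> = \<Union>\<U>" if "\<U> \<subseteq> {U. openin X U}" for \<U>
    using that openin_subset by (intro pow_Sup) auto
  have "(K \<subseteq> \<Squnion>\<^bsub>pow_mt X\<^esub>\<U> \<longrightarrow> (\<exists>\<F>\<subseteq>\<U>. finite \<F> \<and> K \<subseteq> \<Squnion>\<^bsub>pow_mt X\<^esub>\<F>)) \<longleftrightarrow>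
      (K \<subseteq> \<Union>\<U> \<longrightarrow> (\<exists>\<F>. finite \<F> \<and> \<F> \<subseteq> \<U> \<and> K \<subseteq> \<Union>\<F>))"
    if "\<U> \<subseteq> {U. openin X U}" for \<U>
  proof -
    have "\<Squnion>\<^bsub>pow_mt X\<^esub>\<F> = \<Union>\<F>" if "\<F> \<subseteq> \<U>" for \<F>
      using Sup that \<open>\<U> \<subseteq> {U. openin X U}\<close> by (meson subset_trans)
    then have "(\<exists>\<F>\<subseteq>\<U>. finite \<F> \<and> K \<subseteq> \<Squnion>\<^bsub>pow_mt X\<^esub>\<F>) \<longleftrightarrow>
        (\<exists>\<F>. finite \<F> \<and> \<F> \<subseteq> \<U> \<and> K \<subseteq> \<Union>\<F>)"
      by metis
    then show ?thesis using Sup[OF that] by simp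
  qed
  then have "mt_compact (pow_mt X) K \<longleftrightarrow> K \<subseteq> topspace X \<and>
      (\<forall>\<U>\<subseteq>{U. openin X U}. K \<subseteq> \<Union>\<U> \<longrightarrow> (\<exists>\<F>. finite \<F> \<and> \<F> \<subseteq> \<U> \<and> K \<subseteq> \<Union>\<F>))"
    by (simp add: mt_compact_def pow_opens)
  also have "\<dots> \<longleftrightarrow> compactin X K" by (simp add: compactin_def subset_eq imp_conjL)
  finally show ?thesis .
qed

lemma pow_KS_iff: "K \<in> KS (pow_mt X) \<longleftrightarrow> compactin X K \<and> saturated_in X K"
  by (simp add: KS_def pow_compact_iff pow_saturated_iff)

lemma irreducible_closure_of_point:
  assumes "x \<in> topspace X"
  shows "irreducible_closed_in X (X closure_of {x})"
  unfolding irreducible_closed_in_def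
proof (intro conjI allI impI)
  have x: "x \<in> X closure_of {x}" using assms closure_of_subset[of "{x}" X] by simp
  then show "X closure_of {x} \<noteq> {}" by blast
  fix A B assume AB: "closedin X A \<and> closedin X B \<and> X closure_of {x} = A \<union> B"
  then have "x \<in> A \<or> x \<in> B" using x by blast
  then show "X closure_of {x} = A \<or> X closure_of {x} = B"
    using AB closure_of_minimal[of "{x}"] by blast
qed simp

text \<open>Beyond the translation of irreducibility, the work is the T0 condition: a singleton is
  the saturation of its point cut with the closure of that point, and every set is a join of
  singletons.\<close>

lemma mt_sober_pow:
  assumes sober: "sober_space X"
  shows "mt_sober (pow_mt X)"
  unfolding mt_sober_def
proof (intro conjI allI impI)
  have wlc: "weakly_locally_closed (pow_mt X) {x}" if x: "x \<in> topspace X" for x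
  proof -
    define S where "S = topspace X \<inter> \<Inter>{U. openin X U \<and> x \<in> U}"
    have "saturated_in X S" unfolding saturated_in_def S_def by (rule exI[of _ "{U. openin X U \<and> x \<in> U}"]) auto
    \<comment> \<open>Membership in \<open>S\<close> puts \<open>x\<close> into the closure of
      \<open>y\<close>, so both points have the same closure; uniqueness of generic points
      identifies them.\<close>
    moreover have "y = x" if y: "y \<in> S" "y \<in> X closure_of {x}" for y
    proof -
      have yX: "y \<in> topspace X" using y by (simp add: S_def)
      have "x \<in> X closure_of {y}" using x y by (auto simp: in_closure_of S_def)
      then have "X closure_of {x} = X closure_of {y}"
        using y(2) closure_of_minimal[of "{x}" "X closure_of {y}" X]
          closure_of_minimal[of "{y}" "X closure_of {x}" X] by auto
      then show ?thesis
        using sober irreducible_closure_of_point[OF x] x yX unfolding sober_space_def by blast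
    qed
    moreover have "x \<in> S" "x \<in> X closure_of {x}"
      using x closure_of_subset[of "{x}" X] by (auto simp: S_def)
    ultimately have "saturated_in X S" "{x} = S \<inter> X closure_of {x}" by auto
    moreover have "S \<subseteq> topspace X" by (simp add: S_def)
    ultimately show ?thesis
      unfolding weakly_locally_closed_def pow_closeds pow_saturated_iff
      by (intro exI[of _ S] exI[of _ "X closure_of {x}"]) (simp add: pow_meet closure_of_subset_topspace)
  qed
  show "mt_T0 (pow_mt X)"
    unfolding mt_T0_def
  proof
    fix A assume A: "A \<in> carrier (pow_mt X)"
    then have "A = \<Squnion>\<^bsub>pow_mt X\<^esub>((\<lambda>x. {x}) ` A)" by (subst pow_Sup) auto
    then show "\<exists>S. (\<forall>s\<in>S. weakly_locally_closed (pow_mt X) s) \<and> A = \<Squnion>\<^bsub>pow_mt X\<^esub>S"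
      using A wlc by (intro exI[of _ "(\<lambda>x. {x}) ` A"]) auto
  qed
  fix C assume C: "join_irreducible_closed (pow_mt X) C"
  have "irreducible_closed_in X C"
    unfolding irreducible_closed_in_def
  proof (intro conjI allI impI)
    show "closedin X C" "C \<noteq> {}" using C by (auto simp: join_irreducible_closed_def pow_closeds)
    fix A B assume AB: "closedin X A \<and> closedin X B \<and> C = A \<union> B"
    then have "C = A \<squnion>\<^bsub>pow_mt X\<^esub> B" by (simp add: pow_join closedin_subset)
    then show "C = A \<or> C = B" using C AB by (auto simp: join_irreducible_closed_def pow_closeds)
  qed
  then obtain x where "x \<in> topspace X" "C = X closure_of {x}"
    using sober unfolding sober_space_def by blast
  then show "\<exists>x\<in>mt_atoms (pow_mt X). C = mt_diamond (pow_mt X) x"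
    by (auto simp: pow_atoms pow_diamond)
qed

text \<open>Stable compactness of a space only asks that the intersection be compact, whereas
  \<open>KS\<close> also demands saturation; this supplies the missing half.\<close>

lemma saturated_in_Int:
  assumes "saturated_in X A" "saturated_in X B"
  shows "saturated_in X (A \<inter> B)"
proof -
  have "A \<subseteq> topspace X" "B \<subseteq> topspace X" using assms by (auto simp: saturated_in_def)
  then show ?thesis using pow.saturated_meet[of A B] assms by (simp add: pow_saturated_iff pow_meet)
qed

lemma mt_spatial_pow: "mt_spatial (pow_mt X)"
  by (auto simp: mt_spatial_def pow_atoms)

lemma mt_stably_compact_pow:
  assumes "stably_compact_space X"
  shows "mt_stably_compact (pow_mt X)"
  unfolding mt_stably_compact_def mt_stably_locally_compact_def
proof (intro conjI)
  have X: "compact_space X" "sober_space X" "neighbourhood_base_of (compactin X) X"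
    "\<And>K L. \<lbrakk>compactin X K; saturated_in X K; compactin X L; saturated_in X L\<rbrakk> \<Longrightarrow> compactin X (K \<inter> L)"
    using assms by (auto simp: stably_compact_space_def)
  show "mt_sober (pow_mt X)" using X by (simp add: mt_sober_pow)
  show "mt_compact (pow_mt X) \<top>\<^bsub>pow_mt X\<^esub>" using X by (simp add: pow_compact_iff compact_space_def)
  show "\<forall>k\<in>KS (pow_mt X). \<forall>m\<in>KS (pow_mt X). k \<sqinter>\<^bsub>pow_mt X\<^esub> m \<in> KS (pow_mt X)"
    using X(4) by (simp add: pow_KS_iff pow_meet compactin_subset_topspace saturated_in_Int)
  show "mt_locally_compact (pow_mt X)"
    unfolding mt_locally_compact_def
  proof
    fix U assume "U \<in> mt_opens (pow_mt X)"
    then have U: "openin X U" by (simp add: pow_opens)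
    let ?V = "{V \<in> mt_opens (pow_mt X). compactly_below (pow_mt X) V U}"
    have "?V \<subseteq> Pow (topspace X)" by (auto simp: pow_opens dest: openin_subset)
    then have "\<Squnion>\<^bsub>pow_mt X\<^esub>?V = \<Union>?V" by (rule pow_Sup)
    moreover have "\<Union>?V \<subseteq> U" by (auto simp: compactly_below_def)
    moreover have "U \<subseteq> \<Union>?V"
    proof
      fix x assume "x \<in> U"
      then obtain V K where "openin X V" "compactin X K" "x \<in> V" "V \<subseteq> K" "K \<subseteq> U"
        using X(3) U unfolding neighbourhood_base_of by meson
      then show "x \<in> \<Union>?V" by (auto simp: pow_opens compactly_below_def pow_compact_iff)
    qed
    ultimately show "U = \<Squnion>\<^bsub>pow_mt X\<^esub>?V" by auto
  qed
qed

end

section \<open>Morphisms\<close>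

locale mt_morphism = M: mt_algebra M + N: mt_algebra N
  for M :: "('a, 'c) mt_scheme" and N :: "('b, 'd) mt_scheme" +
  fixes f :: "'a \<Rightarrow> 'b"
  assumes hom: "f \<in> mt_hom M N"
begin

lemma maps_closed [simp]: "a \<in> carrier M \<Longrightarrow> f a \<in> carrier N"
  using hom by (auto simp: mt_hom_def)

lemma maps_Sup: "S \<subseteq> carrier M \<Longrightarrow> f (\<Squnion>\<^bsub>M\<^esub>S) = \<Squnion>\<^bsub>N\<^esub>(f ` S)"
  using hom by (simp add: mt_hom_def)

lemma maps_Inf: "S \<subseteq> carrier M \<Longrightarrow> f (\<Sqinter>\<^bsub>M\<^esub>S) = \<Sqinter>\<^bsub>N\<^esub>(f ` S)"
  using hom by (simp add: mt_hom_def)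

lemma maps_compl: "a \<in> carrier M \<Longrightarrow> f (mt_compl M a) = mt_compl N (f a)"
  using hom by (simp add: mt_hom_def)

lemma maps_box: "a \<in> carrier M \<Longrightarrow> f (\<box>\<^bsub>M\<^esub>a) \<sqsubseteq>\<^bsub>N\<^esub> \<box>\<^bsub>N\<^esub>(f a)"
  using hom by (simp add: mt_hom_def)

lemma maps_mono:
  assumes "a \<in> carrier M" "b \<in> carrier M" "a \<sqsubseteq>\<^bsub>M\<^esub> b"
  shows "f a \<sqsubseteq>\<^bsub>N\<^esub> f b"
proof -
  have "\<Sqinter>\<^bsub>M\<^esub>{a, b} = a"
    using M.le_iff_join[of a b] assms by (simp add: meet_def)
  then have "f a = f a \<sqinter>\<^bsub>N\<^esub> f b"
    using maps_Inf[of "{a, b}"] assms by (simp add: meet_def)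
  then show ?thesis using N.le_iff_join[of "f a" "f b"] assms by simp
qed

lemma maps_bottom: "f \<bottom>\<^bsub>M\<^esub> = \<bottom>\<^bsub>N\<^esub>"
  using maps_Sup[of "{}"] M.weak_sup_empty N.weak_sup_empty
  by (simp add: M.eq_is_equal N.eq_is_equal)

lemma maps_open:
  assumes "u \<in> mt_opens M"
  shows "f u \<in> mt_opens N"
proof -
  have "u \<in> carrier M" "\<box>\<^bsub>M\<^esub>u = u" using assms by (auto simp: mt_opens_def)
  then show ?thesis
    using maps_box[of u] N.mbox_le[of "f u"] N.mbox_closed N.le_antisym[of "f u" "\<box>\<^bsub>N\<^esub>(f u)"]
    by (simp add: mt_opens_def)
qed

section \<open>The left adjoint of a morphism on atoms\<close>

lemma at_map_eq: "x \<in> mt_atoms N \<Longrightarrow> at_map M N f x = \<Sqinter>\<^bsub>M\<^esub>{a \<in> carrier M. x \<sqsubseteq>\<^bsub>N\<^esub> f a}"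
  by (simp add: at_map_def)

lemma at_map_closed: "x \<in> mt_atoms N \<Longrightarrow> at_map M N f x \<in> carrier M"
  unfolding at_map_eq by (rule M.inf_closed) auto

text \<open>The adjunction between \<open>at_map M N f\<close> and \<open>f\<close>. Since
  \<open>f\<close> preserves meets, \<open>x\<close> is below the image of the meet that defines
  \<open>at_map M N f x\<close>, so this meet is the least element whose image is above
  \<open>x\<close>.\<close>

lemma at_map_le_iff:
  assumes x: "x \<in> mt_atoms N" and a: "a \<in> carrier M"
  shows "at_map M N f x \<sqsubseteq>\<^bsub>M\<^esub> a \<longleftrightarrow> x \<sqsubseteq>\<^bsub>N\<^esub> f a"
proof
  let ?S = "{a \<in> carrier M. x \<sqsubseteq>\<^bsub>N\<^esub> f a}"
  have xc: "x \<in> carrier N" using x by (rule N.atomD)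
  have S: "?S \<subseteq> carrier M" by auto
  show "at_map M N f x \<sqsubseteq>\<^bsub>M\<^esub> a" if "x \<sqsubseteq>\<^bsub>N\<^esub> f a"
    using M.inf_lower[OF S, of a] that a x by (simp add: at_map_eq)
  assume "at_map M N f x \<sqsubseteq>\<^bsub>M\<^esub> a"
  then have "f (at_map M N f x) \<sqsubseteq>\<^bsub>N\<^esub> f a" using maps_mono at_map_closed x a by simp
  moreover have "x \<sqsubseteq>\<^bsub>N\<^esub> \<Sqinter>\<^bsub>N\<^esub>(f ` ?S)"
    using xc by (subst N.le_Inf_iff) auto
  then have "x \<sqsubseteq>\<^bsub>N\<^esub> f (at_map M N f x)"
    using maps_Inf[OF S] x by (simp add: at_map_eq)
  ultimately show "x \<sqsubseteq>\<^bsub>N\<^esub> f a"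
    using N.le_trans xc a at_map_closed[OF x] by simp
qed

text \<open>The atom \<open>x\<close> is below \<open>f z\<close> or below the image of the
  complement of \<open>z\<close>. By adjunction the same alternative holds for
  \<open>at_map M N f x\<close>, and for \<open>z\<close> below it the second case forces
  \<open>z\<close> to be bottom.\<close>

lemma at_map_atom:
  assumes x: "x \<in> mt_atoms N"
  shows "at_map M N f x \<in> mt_atoms M"
  unfolding mt_atoms_def
proof (intro CollectI conjI ballI impI)
  let ?y = "at_map M N f x"
  have yc: "?y \<in> carrier M" using x by (rule at_map_closed)
  show "?y \<in> carrier M" by fact
  note xD = N.atomD[OF x]
  show "?y \<noteq> \<bottom>\<^bsub>M\<^esub>"
  proof
    assume "?y = \<bottom>\<^bsub>M\<^esub>"
    then have "x \<sqsubseteq>\<^bsub>N\<^esub> \<bottom>\<^bsub>N\<^esub>" using at_map_le_iff[OF x, of "\<bottom>\<^bsub>M\<^esub>"] yc by (simp add: maps_bottom)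
    then show False using xD(1,2) by (simp add: N.le_bottom_iff)
  qed
  fix z assume z: "z \<in> carrier M" "z \<sqsubseteq>\<^bsub>M\<^esub> ?y"
  show "z = \<bottom>\<^bsub>M\<^esub> \<or> z = ?y"
  proof (cases "x \<sqsubseteq>\<^bsub>N\<^esub> f z")
    case True
    then have "?y \<sqsubseteq>\<^bsub>M\<^esub> z" using at_map_le_iff[OF x] z by simp
    then show ?thesis using z yc M.le_antisym by simp
  next
    case False
    then have "x \<sqsubseteq>\<^bsub>N\<^esub> f (mt_compl M z)" using N.atom_le_compl_iff[OF x, of "f z"] z by (simp add: maps_compl)
    then have "?y \<sqsubseteq>\<^bsub>M\<^esub> mt_compl M z" using at_map_le_iff[OF x] z by simp
    then have "z \<sqsubseteq>\<^bsub>M\<^esub> mt_compl M z" using M.le_trans[OF z(2)] z yc by simp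
    then have "z \<sqsubseteq>\<^bsub>M\<^esub> z \<sqinter>\<^bsub>M\<^esub> mt_compl M z" using z by (simp add: M.le_meet_iff)
    then show ?thesis using z by (simp add: M.meet_compl M.le_bottom_iff)
  qed
qed

text \<open>Uniqueness of left adjoints: the map on atoms is identified by checking the adjunction
  instead of computing a meet.\<close>

lemma at_map_eqI:
  assumes "x \<in> mt_atoms N" "y \<in> carrier M" "\<And>a. a \<in> carrier M \<Longrightarrow> y \<sqsubseteq>\<^bsub>M\<^esub> a \<longleftrightarrow> x \<sqsubseteq>\<^bsub>N\<^esub> f a"
  shows "at_map M N f x = y"
  using assms(2,3) at_map_le_iff[OF assms(1)] at_map_closed[OF assms(1)]
  by (intro M.le_antisym) (auto simp flip: assms(3))

lemma at_map_vimage: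
  assumes "a \<in> carrier M"
  shows "{x \<in> mt_atoms N. at_map M N f x \<in> mt_eta M a} = mt_eta N (f a)"
  using assms by (auto simp: M.mem_eta N.mem_eta at_map_le_iff at_map_atom)

end

section \<open>The unit \<open>mt_eta\<close> and the functor \<open>at\<close>\<close>

lemma (in mt_algebra) eta_hom: "mt_eta M \<in> mt_hom M (pow_mt (at_space M))"
proof -
  have "\<box>a \<in> mt_opens M" "\<box>a \<sqsubseteq> a" "\<box>a \<in> carrier M" if "a \<in> carrier M" for a
    using that mbox_le box_open mbox_closed by auto
  \<comment> \<open>The image of \<open>\<box>a\<close> is an open set inside that of
    \<open>a\<close>. It can be smaller than the interior, as an open element may have all its atoms
    below \<open>a\<close> without being below \<open>a\<close>; morphisms ask only for the
    inequality.\<close>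
  then have "mt_eta M (\<box>a) \<subseteq> at_space M interior_of mt_eta M a" if "a \<in> carrier M" for a
    using that by (intro interior_of_maximal eta_mono) (auto simp: openin_at_iff)
  moreover have "mt_eta M (\<Squnion>S) = \<Squnion>\<^bsub>pow_mt (at_space M)\<^esub>(mt_eta M ` S)"
      "mt_eta M (\<Sqinter>S) = \<Sqinter>\<^bsub>pow_mt (at_space M)\<^esub>(mt_eta M ` S)" if "S \<subseteq> carrier M" for S
  proof -
    have "mt_eta M ` S \<subseteq> Pow (topspace (at_space M))"
      using that eta_subset unfolding topspace_at by blast
    then show "mt_eta M (\<Squnion>S) = \<Squnion>\<^bsub>pow_mt (at_space M)\<^esub>(mt_eta M ` S)"
      "mt_eta M (\<Sqinter>S) = \<Sqinter>\<^bsub>pow_mt (at_space M)\<^esub>(mt_eta M ` S)"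
      using that by (simp_all add: pow_Sup pow_Inf eta_Sup eta_Inf topspace_at)
  qed
  moreover have "mt_eta M (mt_compl M a) = mt_compl (pow_mt (at_space M)) (mt_eta M a)"
    if "a \<in> carrier M" for a
    using that by (simp add: pow_compl eta_subset eta_compl topspace_at)
  moreover have "mt_eta M \<in> carrier M \<rightarrow>\<^sub>E Pow (mt_atoms M)"
    using eta_subset by (auto simp: mt_eta_def)
  ultimately show ?thesis by (simp add: mt_hom_def topspace_at)
qed

lemma (in mt_algebra) eta_proper_hom:
  assumes "mt_sober M"
  shows "mt_eta M \<in> mt_proper_hom M (pow_mt (at_space M))"
  using eta_hom eta_compactin[OF assms] eta_saturated
  by (auto simp: mt_proper_hom_def pow_KS_iff KS_iff)

lemma (in mt_morphism) at_map_proper: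
  assumes proper: "f \<in> mt_proper_hom M N" and sober: "mt_sober N"
  shows "at_map M N f \<in> proper_cmap (at_space N) (at_space M)"
  unfolding proper_cmap_def M.topspace_at N.topspace_at
proof (intro CollectI conjI allI impI)
  show "at_map M N f \<in> extensional (mt_atoms N)" by (simp add: at_map_def)
  show "continuous_map (at_space N) (at_space M) (at_map M N f)"
    unfolding continuous_map_def M.topspace_at N.topspace_at
  proof (intro conjI allI impI)
    show "at_map M N f \<in> mt_atoms N \<rightarrow> mt_atoms M" using at_map_atom by auto
    fix U assume "openin (at_space M) U"
    then obtain u where u: "u \<in> mt_opens M" "U = mt_eta M u" by (auto simp: M.openin_at_iff)
    then show "openin (at_space N) {x \<in> mt_atoms N. at_map M N f x \<in> U}"
      using at_map_vimage[of u] maps_open by (auto simp: M.opens_closed N.openin_at_iff)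
  qed
  fix K assume "compactin (at_space M) K \<and> saturated_in (at_space M) K"
  then obtain k where k: "k \<in> KS M" "K = mt_eta M k" using M.compact_saturated_in_at by blast
  then have "{x \<in> mt_atoms N. at_map M N f x \<in> K} = mt_eta N (f k)"
    using at_map_vimage M.KS_closed by simp
  moreover have "f k \<in> KS N" using proper k by (simp add: mt_proper_hom_def)
  ultimately show "compactin (at_space N) {x \<in> mt_atoms N. at_map M N f x \<in> K}"
    using N.eta_compactin sober by simp
qed

lemma (in mt_algebra) id_proper_hom: "mt_id M \<in> mt_proper_hom M M"
proof -
  have "mt_id M ` S = S" if "S \<subseteq> carrier M" for S
    using that by (force simp: mt_id_def)
  then show ?thesis
    by (auto simp: mt_proper_hom_def mt_hom_def mt_id_def mbox_closed KS_closed)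
qed

lemma compose_proper_hom:
  assumes "mt_algebra M" "mt_algebra N" "mt_algebra L"
    and "f \<in> mt_proper_hom M N" "g \<in> mt_proper_hom N L"
  shows "compose (carrier M) g f \<in> mt_proper_hom M L"
proof -
  interpret f: mt_morphism M N f
    using assms by (simp add: mt_morphism_def mt_morphism_axioms_def mt_proper_hom_def)
  interpret g: mt_morphism N L g
    using assms by (simp add: mt_morphism_def mt_morphism_axioms_def mt_proper_hom_def)
  have im: "compose (carrier M) g f ` S = g ` f ` S" if "S \<subseteq> carrier M" for S
    using that by (force simp: compose_def)
  have sub: "f ` S \<subseteq> carrier N" if "S \<subseteq> carrier M" for S
    using that by auto
  \<comment> \<open>The box inequalities of \<open>f\<close> and \<open>g\<close> are chained
    through monotonicity of \<open>g\<close>.\<close>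
  have "g (f (\<box>\<^bsub>M\<^esub>a)) \<sqsubseteq>\<^bsub>L\<^esub> \<box>\<^bsub>L\<^esub>(g (f a))" if a: "a \<in> carrier M" for a
    using g.N.le_trans[OF g.maps_mono[OF _ _ f.maps_box] g.maps_box] a
    by (simp add: f.M.mbox_closed f.N.mbox_closed g.N.mbox_closed)
  moreover have "g (f k) \<in> KS L" if "k \<in> KS M" for k
    using assms(4,5) that by (simp add: mt_proper_hom_def)
  ultimately show ?thesis
    by (simp add: mt_proper_hom_def mt_hom_def im f.maps_Sup f.maps_Inf g.maps_Sup g.maps_Inf sub
        f.maps_compl g.maps_compl compose_eq f.M.mbox_closed f.M.KS_closed)
      (auto simp: compose_def)
qed

text \<open>Left adjoints compose in the opposite order: the composite on the right satisfies the
  adjunction that characterizes the left side.\<close>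

lemma at_map_compose:
  assumes "mt_algebra M" "mt_algebra N" "mt_algebra L"
    and "f \<in> mt_proper_hom M N" "g \<in> mt_proper_hom N L"
  shows "at_map M L (compose (carrier M) g f) =
    compose (topspace (at_space L)) (at_map M N f) (at_map N L g)"
  unfolding mt_algebra.topspace_at[OF assms(3)]
proof (rule extensionalityI)
  interpret f: mt_morphism M N f
    using assms by (simp add: mt_morphism_def mt_morphism_axioms_def mt_proper_hom_def)
  interpret g: mt_morphism N L g
    using assms by (simp add: mt_morphism_def mt_morphism_axioms_def mt_proper_hom_def)
  interpret gf: mt_morphism M L "compose (carrier M) g f"
    using assms compose_proper_hom[OF assms]
    by (simp add: mt_morphism_def mt_morphism_axioms_def mt_proper_hom_def)
  fix x assume x: "x \<in> mt_atoms L"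
  show "at_map M L (compose (carrier M) g f) x = compose (mt_atoms L) (at_map M N f) (at_map N L g) x"
    using x g.at_map_atom[OF x]
    by (intro gf.at_map_eqI)
      (simp_all add: compose_eq f.at_map_closed f.at_map_le_iff g.at_map_le_iff)
qed (simp_all add: at_map_def)

lemma (in mt_algebra) at_map_id: "at_map M M (mt_id M) = space_id (at_space M)"
proof (rule extensionalityI)
  interpret id: mt_morphism M M "mt_id M"
    using id_proper_hom by unfold_locales (simp add: mt_proper_hom_def)
  fix x assume x: "x \<in> mt_atoms M"
  then show "at_map M M (mt_id M) x = space_id (at_space M) x"
    by (intro id.at_map_eqI) (simp_all add: space_id_def topspace_at mt_id_def atomD(1))
qed (simp_all add: at_map_def space_id_def topspace_at)

lemma eta_natural:
  assumes "mt_algebra M" "mt_algebra N" "f \<in> mt_proper_hom M N"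
  shows "compose (carrier M) (pow_map (at_space N) (at_space M) (at_map M N f)) (mt_eta M) =
    compose (carrier M) (mt_eta N) f"
proof (rule extensionalityI)
  interpret f: mt_morphism M N f
    using assms by (simp add: mt_morphism_def mt_morphism_axioms_def mt_proper_hom_def)
  fix a assume a: "a \<in> carrier M"
  then show "compose (carrier M) (pow_map (at_space N) (at_space M) (at_map M N f)) (mt_eta M) a =
      compose (carrier M) (mt_eta N) f a"
    by (simp add: compose_eq pow_map_def f.M.topspace_at f.N.topspace_at f.M.eta_subset f.at_map_vimage)
qed simp_all

text \<open>The singleton of \<open>x\<close> is contained in \<open>mt_eta M a\<close> just when
  \<open>x\<close> is below \<open>a\<close>, so the left adjoint of \<open>mt_eta M\<close> sends
  it to \<open>x\<close>.\<close>

lemma (in mt_algebra) triangle_at: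
  "compose (topspace (at_space M)) (at_map M (pow_mt (at_space M)) (mt_eta M)) (space_eps (at_space M)) =
    space_id (at_space M)"
  unfolding topspace_at
proof (rule extensionalityI)
  interpret eta: mt_morphism M "pow_mt (at_space M)" "mt_eta M"
    using eta_hom mt_algebra_pow mt_algebra_axioms
    by (simp add: mt_morphism_def mt_morphism_axioms_def)
  fix x assume x: "x \<in> mt_atoms M"
  then have "at_map M (pow_mt (at_space M)) (mt_eta M) {x} = x"
    by (intro eta.at_map_eqI) (auto simp: pow_atoms topspace_at atomD(1) mem_eta)
  then show "compose (mt_atoms M) (at_map M (pow_mt (at_space M)) (mt_eta M)) (space_eps (at_space M)) x =
      space_id (at_space M) x"
    using x by (simp add: compose_eq space_eps_def space_id_def topspace_at)
qed (simp_all add: space_id_def topspace_at)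

lemma (in mt_algebra) spatial_eta_subset_iff:
  assumes "mt_spatial M" "a \<in> carrier M" "b \<in> carrier M"
  shows "mt_eta M a \<subseteq> mt_eta M b \<longleftrightarrow> a \<sqsubseteq> b"
proof
  assume sub: "mt_eta M a \<subseteq> mt_eta M b"
  show "a \<sqsubseteq> b"
  proof (rule ccontr)
    assume "\<not> a \<sqsubseteq> b"
    then have "a \<sqinter> mt_compl M b \<noteq> \<bottom>" using assms le_compl_iff[of a "mt_compl M b"] by simp
    then obtain x where x: "x \<in> mt_atoms M" "x \<sqsubseteq> a \<sqinter> mt_compl M b"
      using assms unfolding mt_spatial_def by (meson compl_closed meet_closed)
    then have "x \<in> mt_eta M a" "x \<notin> mt_eta M b"
      using assms by (auto simp: mem_eta le_meet_iff atomD(1) atom_le_compl_iff)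
    then show False using sub by blast
  qed
qed (use assms eta_mono in auto)

text \<open>The inverse takes a set of atoms to its join. Applying \<open>mt_eta M\<close>
  afterwards returns the set, as atoms are join-prime, and spatiality makes \<open>mt_eta M\<close>
  injective; the laws for \<open>g\<close> are inherited from those for
  \<open>mt_eta M\<close>.\<close>

lemma (in mt_algebra) eta_proper_iso:
  assumes sober: "mt_sober M" and spatial: "mt_spatial M"
  shows "mt_proper_iso M (pow_mt (at_space M)) (mt_eta M)"
proof -
  let ?P = "pow_mt (at_space M)"
  define g where "g = (\<lambda>A\<in>Pow (mt_atoms M). \<Squnion>A)"
  have sub: "A \<subseteq> carrier M" if "A \<subseteq> mt_atoms M" for A using that atomD(1) by auto
  have gc: "g A \<in> carrier M" if "A \<subseteq> mt_atoms M" for A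
    using that by (simp add: g_def sub)
  have eta_g: "mt_eta M (g A) = A" if A: "A \<subseteq> mt_atoms M" for A
  proof -
    have "mt_eta M x = {x}" if "x \<in> mt_atoms M" for x
    proof -
      have "y = x" if "y \<in> mt_atoms M" "y \<sqsubseteq> x" for y
        using atomD(3)[OF \<open>x \<in> mt_atoms M\<close>, of y] atomD(1,2)[OF that(1)] that by auto
      then show ?thesis using that by (auto simp: mem_eta atomD(1))
    qed
    then have "mt_eta M ` A = (\<lambda>x. {x}) ` A" using A by (intro image_cong) auto
    then show ?thesis using A by (simp add: g_def eta_Sup sub)
  qed
  have inj: "a = b" if "mt_eta M a = mt_eta M b" "a \<in> carrier M" "b \<in> carrier M" for a b
    using that spatial_eta_subset_iff[OF spatial] by (intro le_antisym) auto
  have g_eta: "g (mt_eta M a) = a" if "a \<in> carrier M" for a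
    using that by (intro inj eta_g gc eta_subset)
  \<comment> \<open>An equation for \<open>g\<close> is thereby reduced to one for
    \<open>mt_eta M\<close>.\<close>
  have gI: "g A = a" if "A = mt_eta M a" "a \<in> carrier M" for A a
    using that g_eta by simp
  have "g \<in> mt_hom ?P M"
    unfolding mt_hom_def pow_simps topspace_at
  proof (intro CollectI conjI allI ballI impI)
    show "g \<in> Pow (mt_atoms M) \<rightarrow>\<^sub>E carrier M" using gc by (auto simp: g_def)
    fix \<A> assume A: "\<A> \<subseteq> Pow (mt_atoms M)"
    then have c: "g ` \<A> \<subseteq> carrier M" using gc by auto
    have "mt_eta M ` g ` \<A> = (\<lambda>A. A) ` \<A>"
      unfolding image_image using A eta_g by (intro image_cong) auto
    then have "\<Squnion>\<^bsub>?P\<^esub>\<A> = mt_eta M (\<Squnion>(g ` \<A>))" "\<Sqinter>\<^bsub>?P\<^esub>\<A> = mt_eta M (\<Sqinter>(g ` \<A>))"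
      using A c by (simp_all add: pow_Sup pow_Inf topspace_at eta_Sup eta_Inf)
    then show "g (\<Squnion>\<^bsub>?P\<^esub>\<A>) = \<Squnion>(g ` \<A>)" "g (\<Sqinter>\<^bsub>?P\<^esub>\<A>) = \<Sqinter>(g ` \<A>)"
      using c gI by simp_all
  next
    fix A assume A: "A \<in> Pow (mt_atoms M)"
    then show "g (mt_compl ?P A) = mt_compl M (g A)"
      by (intro gI) (simp_all add: pow_compl topspace_at eta_compl gc eta_g)
    \<comment> \<open>For the box, the interior is named by an open element \<open>u\<close>;
      reflecting the order puts \<open>u\<close> below the join of \<open>A\<close>, and an open
      element below something is below its box.\<close>
    obtain u where u: "u \<in> mt_opens M" "at_space M interior_of A = mt_eta M u"
      using openin_interior_of openin_at_iff by blast
    then have "mt_eta M u \<subseteq> mt_eta M (g A)" using A eta_g[of A] interior_of_subset[of "at_space M" A] by simp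
    then have "u \<sqsubseteq> g A" using A u gc spatial by (simp add: spatial_eta_subset_iff opens_closed)
    then have "u \<sqsubseteq> \<box>(g A)" using A u gc by (simp add: open_le_box_iff)
    then show "g (at_space M interior_of A) \<sqsubseteq> \<box>(g A)" using u by (simp add: g_eta opens_closed)
  qed
  moreover have "g K \<in> KS M" if K: "K \<in> KS ?P" for K
  proof -
    obtain k where "k \<in> KS M" "K = mt_eta M k"
      using K compact_saturated_in_at[of K] by (auto simp: pow_KS_iff)
    then show ?thesis by (simp add: g_eta KS_closed)
  qed
  ultimately have "g \<in> mt_proper_hom ?P M" by (simp add: mt_proper_hom_def)
  moreover have "compose (carrier M) g (mt_eta M) = mt_id M"
    unfolding compose_def mt_id_def by (rule restrict_ext) (simp add: g_eta)
  moreover have "compose (carrier ?P) (mt_eta M) g = mt_id ?P"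
    unfolding compose_def mt_id_def by (rule restrict_ext) (simp add: topspace_at eta_g)
  ultimately show ?thesis using eta_proper_hom[OF sober] by (auto simp: mt_proper_iso_def)
qed

section \<open>Proper maps and the powerset functor\<close>

text \<open>Properness of a map speaks only of compactness of preimages. Their saturation, needed
  for composing proper maps and for landing in \<open>KS\<close>, comes from continuity.\<close>

lemma vimage_saturated_in:
  assumes "continuous_map X Y f" "saturated_in Y K"
  shows "saturated_in X {x \<in> topspace X. f x \<in> K}"
proof -
  obtain \<U> where U: "\<forall>U\<in>\<U>. openin Y U" "K = topspace Y \<inter> \<Inter>\<U>"
    using assms by (auto simp: saturated_in_def)
  let ?\<V> = "(\<lambda>U. {x \<in> topspace X. f x \<in> U}) ` \<U>"
  have "\<forall>V\<in>?\<V>. openin X V" using U assms by (auto simp: openin_continuous_map_preimage)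
  moreover have "{x \<in> topspace X. f x \<in> K} = topspace X \<inter> \<Inter>?\<V>"
    using U assms(1) by (auto simp: continuous_map_def)
  ultimately show ?thesis unfolding saturated_in_def by blast
qed

lemma space_id_proper: "space_id X \<in> proper_cmap X X"
proof -
  have "{x \<in> topspace X. space_id X x \<in> K} = K" if "K \<subseteq> topspace X" for K
    using that by (auto simp: space_id_def)
  moreover have "continuous_map X X (space_id X)"
    by (rule continuous_map_eq[of X X id]) (auto simp: space_id_def)
  ultimately show ?thesis
    by (auto simp: proper_cmap_def space_id_def compactin_subset_topspace)
qed

lemma compose_proper_cmap:
  assumes f: "f \<in> proper_cmap X Y" and g: "g \<in> proper_cmap Y Z"
  shows "compose (topspace X) g f \<in> proper_cmap X Z"
proof -
  have cf: "continuous_map X Y f" and cg: "continuous_map Y Z g"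
    using f g by (auto simp: proper_cmap_def)
  have "continuous_map X Z (compose (topspace X) g f)"
    by (rule continuous_map_eq[OF continuous_map_compose[OF cf cg]]) (simp add: compose_def)
  moreover have "compactin X {x \<in> topspace X. compose (topspace X) g f x \<in> K}"
    if K: "compactin Z K" "saturated_in Z K" for K
  proof -
    let ?L = "{y \<in> topspace Y. g y \<in> K}"
    have "compactin Y ?L" "saturated_in Y ?L"
      using K g vimage_saturated_in[OF cg] by (auto simp: proper_cmap_def)
    then have "compactin X {x \<in> topspace X. f x \<in> ?L}" using f unfolding proper_cmap_def by blast
    moreover have "{x \<in> topspace X. f x \<in> ?L} = {x \<in> topspace X. compose (topspace X) g f x \<in> K}"
      using cf by (auto simp: compose_def continuous_map_def)
    ultimately show ?thesis by simp
  qed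
  ultimately show ?thesis by (simp add: proper_cmap_def)
qed

lemma pow_map_proper_hom:
  assumes f: "f \<in> proper_cmap X Y"
  shows "pow_map X Y f \<in> mt_proper_hom (pow_mt Y) (pow_mt X)"
proof -
  have cf: "continuous_map X Y f" using f by (simp add: proper_cmap_def)
  then have fX: "f x \<in> topspace Y" if "x \<in> topspace X" for x
    using that by (auto simp: continuous_map_def)
  have eq: "pow_map X Y f B = {x \<in> topspace X. f x \<in> B}" if "B \<subseteq> topspace Y" for B
    using that by (simp add: pow_map_def)
  have img: "pow_map X Y f ` \<B> = (\<lambda>B. {x \<in> topspace X. f x \<in> B}) ` \<B>" if "\<B> \<subseteq> Pow (topspace Y)" for \<B>
    using that eq by (intro image_cong) auto
  have "pow_map X Y f \<in> mt_hom (pow_mt Y) (pow_mt X)"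
    unfolding mt_hom_def pow_simps
  proof (intro CollectI conjI allI ballI impI)
    show "pow_map X Y f \<in> Pow (topspace Y) \<rightarrow>\<^sub>E Pow (topspace X)" by (auto simp: pow_map_def)
    fix \<B> assume B: "\<B> \<subseteq> Pow (topspace Y)"
    let ?\<C> = "(\<lambda>B. {x \<in> topspace X. f x \<in> B}) ` \<B>"
    have C: "?\<C> \<subseteq> Pow (topspace X)" by auto
    have "\<Union>\<B> \<subseteq> topspace Y" using B by auto
    then show "pow_map X Y f (\<Squnion>\<^bsub>pow_mt Y\<^esub>\<B>) = \<Squnion>\<^bsub>pow_mt X\<^esub>(pow_map X Y f ` \<B>)"
      using B unfolding img[OF B] pow_Sup[OF C] by (auto simp: pow_Sup eq)
    show "pow_map X Y f (\<Sqinter>\<^bsub>pow_mt Y\<^esub>\<B>) = \<Sqinter>\<^bsub>pow_mt X\<^esub>(pow_map X Y f ` \<B>)"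
      using B unfolding img[OF B] pow_Inf[OF C] by (auto simp: pow_Inf eq fX)
  next
    fix B assume "B \<in> Pow (topspace Y)"
    then have B: "B \<subseteq> topspace Y" by simp
    then show "pow_map X Y f (mt_compl (pow_mt Y) B) = mt_compl (pow_mt X) (pow_map X Y f B)"
      by (subst pow_compl) (auto simp: pow_compl eq fX)
    have "openin X {x \<in> topspace X. f x \<in> Y interior_of B}"
      using cf by (simp add: openin_continuous_map_preimage)
    then show "pow_map X Y f (Y interior_of B) \<subseteq> X interior_of (pow_map X Y f B)"
      using B interior_of_subset[of Y B]
      by (intro interior_of_maximal) (auto simp: eq interior_of_subset_topspace)
  qed
  moreover have "pow_map X Y f K \<in> KS (pow_mt X)" if "K \<in> KS (pow_mt Y)" for K
  proof -
    have "compactin Y K" "saturated_in Y K" using that by (auto simp: pow_KS_iff)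
    then show ?thesis
      using f vimage_saturated_in[OF cf] compactin_subset_topspace[of Y K]
      by (simp add: pow_KS_iff eq proper_cmap_def)
  qed
  ultimately show ?thesis by (simp add: mt_proper_hom_def)
qed

lemma pow_map_id: "pow_map X X (space_id X) = mt_id (pow_mt X)"
  unfolding pow_map_def mt_id_def pow_simps by (rule restrict_ext) (auto simp: space_id_def)

lemma pow_map_compose:
  assumes "f \<in> proper_cmap X Y" "g \<in> proper_cmap Y Z"
  shows "pow_map X Z (compose (topspace X) g f) =
    compose (carrier (pow_mt Z)) (pow_map X Y f) (pow_map Y Z g)"
proof (rule extensionalityI)
  have "f x \<in> topspace Y" if "x \<in> topspace X" for x
    using that assms by (auto simp: proper_cmap_def continuous_map_def)
  then show "pow_map X Z (compose (topspace X) g f) C =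
      compose (carrier (pow_mt Z)) (pow_map X Y f) (pow_map Y Z g) C" if "C \<in> Pow (topspace Z)" for C
    using that by (auto simp: pow_map_def compose_def)
qed (simp_all add: pow_map_def compose_def)

section \<open>The unit \<open>space_eps\<close> and its naturality\<close>

lemma openin_at_pow_iff:
  "openin (at_space (pow_mt X)) V \<longleftrightarrow> (\<exists>U. openin X U \<and> V = (\<lambda>x. {x}) ` U)"
proof -
  interpret pow: mt_algebra "pow_mt X" by (rule mt_algebra_pow)
  show ?thesis by (auto simp: pow.openin_at_iff pow_opens pow_eta openin_subset)
qed

lemma topspace_at_pow: "topspace (at_space (pow_mt X)) = (\<lambda>x. {x}) ` topspace X"
proof -
  interpret pow: mt_algebra "pow_mt X" by (rule mt_algebra_pow)
  show ?thesis by (simp add: pow.topspace_at pow_atoms)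
qed

text \<open>The atoms of the powerset are the singletons and its open elements are the open sets, so
  the space of atoms is a relabelled copy of \<open>X\<close>. Restricting \<open>the_elem\<close>
  makes the inverse an extensional map.\<close>

lemma homeomorphic_maps_eps:
  "homeomorphic_maps X (at_space (pow_mt X)) (space_eps X) (\<lambda>A\<in>topspace (at_space (pow_mt X)). the_elem A)"
  unfolding homeomorphic_maps_def
proof (intro conjI ballI)
  have "{x \<in> topspace X. space_eps X x \<in> (\<lambda>x. {x}) ` U} = U" if "openin X U" for U
    using openin_subset[OF that] by (auto simp: space_eps_def)
  moreover have "space_eps X \<in> topspace X \<rightarrow> (\<lambda>x. {x}) ` topspace X"
    by (auto simp: space_eps_def)
  ultimately show "continuous_map X (at_space (pow_mt X)) (space_eps X)"
    unfolding continuous_map_def topspace_at_pow openin_at_pow_iff by auto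
  have "{A \<in> (\<lambda>x. {x}) ` topspace X. the_elem A \<in> U} = (\<lambda>x. {x}) ` U" if "U \<subseteq> topspace X" for U
    using that by auto
  then have "continuous_map (at_space (pow_mt X)) X the_elem"
    unfolding continuous_map_def topspace_at_pow openin_at_pow_iff
    by (auto simp: openin_subset)
  then show "continuous_map (at_space (pow_mt X)) X (\<lambda>A\<in>topspace (at_space (pow_mt X)). the_elem A)"
    by (rule continuous_map_eq) simp
qed (auto simp: topspace_at_pow space_eps_def)

text \<open>The preimage of a set under \<open>f\<close> is its image under the continuous inverse
  \<open>g\<close>, and continuous images of compact sets are compact.\<close>

lemma homeomorphic_maps_proper_cmap:
  assumes h: "homeomorphic_maps X Y f g" and ext: "f \<in> extensional (topspace X)"
  shows "f \<in> proper_cmap X Y"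
proof -
  have c: "continuous_map X Y f" "continuous_map Y X g"
    using h by (auto simp: homeomorphic_maps_def)
  have gf: "\<And>x. x \<in> topspace X \<Longrightarrow> g (f x) = x" and fg: "\<And>y. y \<in> topspace Y \<Longrightarrow> f (g y) = y"
    and gX: "\<And>y. y \<in> topspace Y \<Longrightarrow> g y \<in> topspace X"
    using h by (auto simp: homeomorphic_maps_def continuous_map_def)
  have "{x \<in> topspace X. f x \<in> K} = g ` K" if K: "K \<subseteq> topspace Y" for K
  proof (intro equalityI subsetI)
    fix x assume "x \<in> {x \<in> topspace X. f x \<in> K}"
    then show "x \<in> g ` K" using gf[of x] by (intro image_eqI[of _ _ "f x"]) auto
  next
    fix x assume "x \<in> g ` K"
    then show "x \<in> {x \<in> topspace X. f x \<in> K}" using K fg gX by auto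
  qed
  then have "compactin X {x \<in> topspace X. f x \<in> K}" if "compactin Y K" for K
    using image_compactin[OF that c(2)] compactin_subset_topspace[OF that] by simp
  then show ?thesis using c ext by (simp add: proper_cmap_def)
qed

lemma eps_proper_homeo: "proper_homeo X (at_space (pow_mt X)) (space_eps X)"
proof -
  let ?Y = "at_space (pow_mt X)"
  let ?g = "\<lambda>A\<in>topspace ?Y. the_elem A"
  note h = homeomorphic_maps_eps[of X]
  have "space_eps X \<in> proper_cmap X ?Y"
    using h by (rule homeomorphic_maps_proper_cmap) (simp add: space_eps_def)
  moreover have "?g \<in> proper_cmap ?Y X"
    using homeomorphic_maps_sym[THEN iffD1, OF h] by (rule homeomorphic_maps_proper_cmap) simp
  moreover have "compose (topspace X) ?g (space_eps X) = space_id X"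
    by (auto simp: compose_def space_id_def space_eps_def topspace_at_pow)
  moreover have "compose (topspace ?Y) (space_eps X) ?g = space_id ?Y"
    by (rule extensionalityI[of _ "topspace ?Y"])
      (auto simp: compose_def space_id_def space_eps_def topspace_at_pow)
  ultimately show ?thesis unfolding proper_homeo_def by blast
qed

lemma eps_natural:
  assumes f: "f \<in> proper_cmap X Y"
  shows "compose (topspace X) (at_map (pow_mt Y) (pow_mt X) (pow_map X Y f)) (space_eps X) =
    compose (topspace X) (space_eps Y) f"
proof (rule extensionalityI)
  interpret pf: mt_morphism "pow_mt Y" "pow_mt X" "pow_map X Y f"
    using pow_map_proper_hom[OF f]
    by (simp add: mt_morphism_def mt_morphism_axioms_def mt_proper_hom_def mt_algebra_pow)
  fix x assume x: "x \<in> topspace X"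
  then have fx: "f x \<in> topspace Y" using f by (auto simp: proper_cmap_def continuous_map_def)
  \<comment> \<open>The adjunction reads: \<open>f x\<close> lies in a set exactly when
    \<open>x\<close> lies in its preimage.\<close>
  have "at_map (pow_mt Y) (pow_mt X) (pow_map X Y f) {x} = {f x}"
    using x fx by (intro pf.at_map_eqI) (auto simp: pow_atoms pow_map_def)
  then show "compose (topspace X) (at_map (pow_mt Y) (pow_mt X) (pow_map X Y f)) (space_eps X) x =
      compose (topspace X) (space_eps Y) f x"
    using x fx by (simp add: compose_eq space_eps_def)
qed simp_all

lemma triangle_pow:
  "compose (carrier (pow_mt X)) (pow_map X (at_space (pow_mt X)) (space_eps X)) (mt_eta (pow_mt X)) =
    mt_id (pow_mt X)"
proof (rule extensionalityI)
  fix A assume "A \<in> Pow (topspace X)"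
  then have A: "A \<subseteq> topspace X" by simp
  then have "(\<lambda>x. {x}) ` A \<subseteq> (\<lambda>x. {x}) ` topspace X" by auto
  then show "compose (carrier (pow_mt X)) (pow_map X (at_space (pow_mt X)) (space_eps X)) (mt_eta (pow_mt X)) A =
      mt_id (pow_mt X) A"
    using A by (auto simp: compose_def pow_eta pow_map_def topspace_at_pow space_eps_def mt_id_def)
qed (simp_all add: mt_id_def compose_def)

section \<open>The duality\<close>

lemma StKMTD:
  assumes "M \<in> StKMT"
  shows "mt_algebra M" "mt_stably_compact M" "mt_sober M"
  using assms by (auto simp: StKMT_def mt_stably_compact_def mt_stably_locally_compact_def)

lemma StKSMTD: "M \<in> StKSMT \<Longrightarrow> M \<in> StKMT" "M \<in> StKSMT \<Longrightarrow> mt_spatial M"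
  by (auto simp: StKSMT_def)

lemma pow_StKMT: "X \<in> StKSob \<Longrightarrow> pow_mt X \<in> StKMT"
  by (simp add: StKSob_def StKMT_def mt_algebra_pow mt_stably_compact_pow)

lemma pow_StKSMT: "X \<in> StKSob \<Longrightarrow> pow_mt X \<in> StKSMT"
  by (simp add: StKSMT_def pow_StKMT mt_spatial_pow)

lemma at_StKSob: "M \<in> StKMT \<Longrightarrow> at_space M \<in> StKSob"
  by (simp add: StKSob_def StKMT_def mt_algebra.stably_compact_space_at)

lemma at_map_proper_cmap:
  assumes "M \<in> StKMT" "N \<in> StKMT" "f \<in> mt_proper_hom M N"
  shows "at_map M N f \<in> proper_cmap (at_space N) (at_space M)"
  using assms StKMTD(1)[OF assms(1)] StKMTD(1,3)[OF assms(2)]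
  by (intro mt_morphism.at_map_proper)
    (simp_all add: mt_morphism_def mt_morphism_axioms_def mt_proper_hom_def)

text \<open>The adjunction is expressed by units and triangle identities. For the equivalence both
  units must be isomorphisms with proper inverses; as \<open>StKSMT\<close> is a full subcategory,
  functoriality and naturality are inherited from \<open>StKMT\<close>.\<close>

theorem theorem5p14:
  shows
    \<comment> \<open>StKSob and StKMT are categories: identities and composites of morphisms\<close>
    "(\<forall>X \<in> (StKSob :: 'a topology set). space_id X \<in> proper_cmap X X) \<and>
     (\<forall>X \<in> (StKSob :: 'a topology set). \<forall>Y \<in> (StKSob :: 'b topology set).
        \<forall>Z \<in> (StKSob :: 'c topology set). \<forall>f \<in> proper_cmap X Y. \<forall>g \<in> proper_cmap Y Z.
          compose (topspace X) g f \<in> proper_cmap X Z) \<and>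
     (\<forall>M \<in> (StKMT :: 'p mt set). mt_id M \<in> mt_proper_hom M M) \<and>
     (\<forall>M \<in> (StKMT :: 'p mt set). \<forall>N \<in> (StKMT :: 'q mt set). \<forall>L \<in> (StKMT :: 'r mt set).
        \<forall>f \<in> mt_proper_hom M N. \<forall>g \<in> mt_proper_hom N L.
          compose (carrier M) g f \<in> mt_proper_hom M L) \<and>
     (\<comment> \<open>P is a contravariant functor from StKSob to StKMT\<close>
     (\<forall>X \<in> (StKSob :: 'a topology set). pow_mt X \<in> StKMT) \<and>
     (\<forall>X \<in> (StKSob :: 'a topology set). \<forall>Y \<in> (StKSob :: 'b topology set).
        \<forall>f \<in> proper_cmap X Y. pow_map X Y f \<in> mt_proper_hom (pow_mt Y) (pow_mt X)) \<and>
     (\<forall>X \<in> (StKSob :: 'a topology set). pow_map X X (space_id X) = mt_id (pow_mt X)) \<and>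
     (\<forall>X \<in> (StKSob :: 'a topology set). \<forall>Y \<in> (StKSob :: 'b topology set).
        \<forall>Z \<in> (StKSob :: 'c topology set). \<forall>f \<in> proper_cmap X Y. \<forall>g \<in> proper_cmap Y Z.
          pow_map X Z (compose (topspace X) g f) =
            compose (carrier (pow_mt Z)) (pow_map X Y f) (pow_map Y Z g))) \<and>
     (\<comment> \<open>at is a contravariant functor from StKMT to StKSob\<close>
     (\<forall>M \<in> (StKMT :: 'p mt set). at_space M \<in> StKSob) \<and>
     (\<forall>M \<in> (StKMT :: 'p mt set). \<forall>N \<in> (StKMT :: 'q mt set).
        \<forall>f \<in> mt_proper_hom M N. at_map M N f \<in> proper_cmap (at_space N) (at_space M)) \<and>
     (\<forall>M \<in> (StKMT :: 'p mt set). at_map M M (mt_id M) = space_id (at_space M)) \<and>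
     (\<forall>M \<in> (StKMT :: 'p mt set). \<forall>N \<in> (StKMT :: 'q mt set). \<forall>L \<in> (StKMT :: 'r mt set).
        \<forall>f \<in> mt_proper_hom M N. \<forall>g \<in> mt_proper_hom N L.
          at_map M L (compose (carrier M) g f) =
            compose (topspace (at_space L)) (at_map M N f) (at_map N L g))) \<and>
     (\<comment> \<open>the units are natural transformations with values in StKSob and StKMT\<close>
     (\<forall>X \<in> (StKSob :: 'a topology set). space_eps X \<in> proper_cmap X (at_space (pow_mt X))) \<and>
     (\<forall>X \<in> (StKSob :: 'a topology set). \<forall>Y \<in> (StKSob :: 'b topology set). \<forall>f \<in> proper_cmap X Y.
        compose (topspace X) (at_map (pow_mt Y) (pow_mt X) (pow_map X Y f)) (space_eps X) =
          compose (topspace X) (space_eps Y) f) \<and>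
     (\<forall>M \<in> (StKMT :: 'p mt set). mt_eta M \<in> mt_proper_hom M (pow_mt (at_space M))) \<and>
     (\<forall>M \<in> (StKMT :: 'p mt set). \<forall>N \<in> (StKMT :: 'q mt set). \<forall>f \<in> mt_proper_hom M N.
        compose (carrier M) (pow_map (at_space N) (at_space M) (at_map M N f)) (mt_eta M) =
          compose (carrier M) (mt_eta N) f)) \<and>
     (\<comment> \<open>triangle identities of the dual adjunction\<close>
     (\<forall>X \<in> (StKSob :: 'a topology set).
        compose (carrier (pow_mt X))
          (pow_map X (at_space (pow_mt X)) (space_eps X)) (mt_eta (pow_mt X)) =
            mt_id (pow_mt X)) \<and>
     (\<forall>M \<in> (StKMT :: 'p mt set).
        compose (topspace (at_space M))
          (at_map M (pow_mt (at_space M)) (mt_eta M)) (space_eps (at_space M)) =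
            space_id (at_space M))) \<and>
     (\<comment> \<open>dual equivalence between StKSob and StKSMT\<close>
     (\<forall>X \<in> (StKSob :: 'a topology set). pow_mt X \<in> StKSMT) \<and>
     (\<forall>X \<in> (StKSob :: 'a topology set). proper_homeo X (at_space (pow_mt X)) (space_eps X)) \<and>
     (\<forall>M \<in> (StKSMT :: 'p mt set). mt_proper_iso M (pow_mt (at_space M)) (mt_eta M)))"
  apply (intro conjI ballI)
  subgoal by (rule space_id_proper)
  subgoal by (rule compose_proper_cmap)
  subgoal by (simp add: mt_algebra.id_proper_hom StKMTD)
  subgoal by (rule compose_proper_hom; (assumption | erule StKMTD))
  subgoal by (rule pow_StKMT)
  subgoal by (rule pow_map_proper_hom)
  subgoal by (rule pow_map_id)
  subgoal by (rule pow_map_compose)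
  subgoal by (rule at_StKSob)
  subgoal by (rule at_map_proper_cmap)
  subgoal by (simp add: mt_algebra.at_map_id StKMTD)
  subgoal by (rule at_map_compose; (assumption | erule StKMTD))
  subgoal by (rule eps_proper_homeo[unfolded proper_homeo_def, THEN conjunct1])
  subgoal by (rule eps_natural)
  subgoal by (simp add: mt_algebra.eta_proper_hom StKMTD)
  subgoal by (rule eta_natural; (assumption | erule StKMTD))
  subgoal by (rule triangle_pow)
  subgoal by (simp add: mt_algebra.triangle_at StKMTD)
  subgoal by (rule pow_StKSMT)
  subgoal by (rule eps_proper_homeo)
  subgoal by (simp add: mt_algebra.eta_proper_iso StKMTD StKSMTD)
  done

end
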